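(* Let $x=\cos\theta\in[-1,1]$, $|t|<\min\{(1-\beta^2)(1+\sqrt q|\beta|)(1-q|\gamma|),1\}$, $\beta,\gamma\in(-1,1)\setminus\{0\}$, and $0<|q|<1$. Then $${}_2\phi_1\!\left(\beta^{1/2}e^{i\theta},(q\beta)^{1/2}e^{i\theta};\beta q^{1/2};q,te^{-i\theta}\right)\,{}_2\phi_1\!\left(-\beta^{1/2}e^{-i\theta},-(q\beta)^{1/2}e^{-i\theta};\beta q^{1/2};q,te^{i\theta}\right)$$ $$=\sum_{n=0}^\infty\frac{(\pm\beta,-\beta q^{1/2};q)_n\,t^n}{(\gamma,\beta^2,\beta q^{1/2};q)_n}\,C_n(x;\gamma|q)\,\Phi_n,$$ where $\Phi_n$ is the series ${}_{10}\phi_9$ with base $q$, argument $\gamma t^2$, upper parameters $$\beta\gamma^{-1},\ \beta q^n,\ \pm i(\beta q^n)^{1/2},\ \pm i(\beta q^{n+1})^{1/2},\ \pm i(\beta q^{n+1/2})^{1/2},\ \pm i(\beta q^{n+3/2})^{1/2},$$ and lower parameters $$\gamma q^{n+1},\ \pm\beta q^{n/2},\ \pm\beta q^{(n+1)/2},\ \pm(\beta q^{n+1/2})^{1/2},\ \pm(\beta q^{n+3/2})^{1/2}.$$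
   Context: Notation: $(a;q)_0=1$, $(a;q)_n=\prod_{j=0}^{n-1}(1-aq^j)$, $(a;q)_\infty=\prod_{j\ge0}(1-aq^j)$, $(a_1,\dots,a_r;q)_n=\prod_i(a_i;q)_n$. In a list of parameters, $\pm a$ stands for the two entries $a,-a$. Square roots are taken consistently: $(q\beta)^{1/2}=q^{1/2}\beta^{1/2}$. The basic hypergeometric series, with upper parameters listed before the first semicolon and lower parameters before the second, is $${}_r\phi_s(a_1,\dots,a_r;b_1,\dots,b_s;q,z)=\sum_{k=0}^\infty\frac{(a_1,\dots,a_r;q)_k}{(q,b_1,\dots,b_s;q)_k}\left((-1)^kq^{\binom k2}\right)^{1+s-r}z^k.$$ The continuous $q$-ultraspherical/Rogers polynomials are, for $x=\cos\theta$, $$C_n(x;\beta|q)=\frac{(\beta;q)_n}{(q;q)_n}e^{in\theta}\,{}_2\phi_1\!\left(q^{-n},\beta;\beta^{-1}q^{1-n};q,q\beta^{-1}e^{-2i\theta}\right).$$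
   Formalization: For q not in (0,1) the product (1-β²)(1+√q|β|)(1-q|γ|) is in general not real, so the bound on |t| is undefined; it is read with the absolute value of this product, which changes nothing when the product is a positive real. *)

theory Defs
  imports "HOL-Analysis.Analysis"
begin

definition qpoch :: "complex \<Rightarrow> complex \<Rightarrow> nat \<Rightarrow> complex" where
  "qpoch a q n = (\<Prod>j<n. 1 - a * q ^ j)"

definition qpochs :: "complex list \<Rightarrow> complex \<Rightarrow> nat \<Rightarrow> complex" where
  "qpochs as q n = (\<Prod>a\<leftarrow>as. qpoch a q n)"

definition pm :: "complex \<Rightarrow> complex list" where
  "pm a = [a, - a]"

text \<open>
  The basic hypergeometric series with r upper parameters \<open>as\<close> and s lower parameters \<open>bs\<close>.
  The exponent 1 + s - r may be negative, hence the integer power. A series that terminates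
  because of an upper parameter of the form q to the power -n also terminates here if some
  lower factor vanishes at an index k > n, since then 0 / 0 = 0.
\<close>

definition qphi :: "complex list \<Rightarrow> complex list \<Rightarrow> complex \<Rightarrow> complex \<Rightarrow> complex" where
  "qphi as bs q z =
     (\<Sum>k. qpochs as q k / qpochs (q # bs) q k
            * ((- 1) ^ k * q ^ (k choose 2)) powi (1 + int (length bs) - int (length as))
            * z ^ k)"

text \<open>
  The continuous q-ultraspherical (Rogers) polynomials as functions of x, where the angle
  \<open>\<theta>\<close> with x = cos \<open>\<theta>\<close> is the principal one. For x in [-1, 1] it is the usual real arccosine.
\<close>

definition rogers_C :: "nat \<Rightarrow> complex \<Rightarrow> complex \<Rightarrow> complex \<Rightarrow> complex" where
  "rogers_C n x \<beta> q =
     (let \<theta> = Arccos x in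
        qpoch \<beta> q n / qpoch q q n * exp (\<i> * of_nat n * \<theta>)
        * qphi [q powi (- int n), \<beta>] [inverse \<beta> * q powi (1 - int n)] q
            (q * inverse \<beta> * exp (- 2 * \<i> * \<theta>)))"

end

theory Submission
  imports Defs
begin

text \<open>
  The identity is the composition of two expansions in Rogers polynomials.

  The first expands the product of the two \<open>2\<phi>1\<close> series in the polynomials whose parameter is the
  \<open>\<beta>\<close> of the product: the coefficient of \<open>t ^ n\<close> is
  \<open>(- \<beta>, - \<beta> q\<^sup>1\<^sup>/\<^sup>2; q)\<^sub>n / (\<beta>\<^sup>2, \<beta> q\<^sup>1\<^sup>/\<^sup>2; q)\<^sub>n\<close> times \<open>C\<^sub>n(x; \<beta>|q)\<close>
  (\<open>product_generating_function\<close>). The coefficient of \<open>t ^ n\<close> in the product is a convolution sum. Creative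
  telescoping shows that this sum satisfies a three-term recurrence in \<open>n\<close>
  (\<open>generating_coeff_recurrence\<close>), and it is the recurrence of the Rogers polynomials up to the factor
  above (\<open>product_coeff_eq\<close>).

  The second is the connection formula of Rogers, which writes \<open>C\<^sub>n(x; \<beta>|q)\<close> as a combination of
  the \<open>C\<^sub>m(x; \<gamma>|q)\<close> with \<open>m + 2 k = n\<close> (\<open>rogers_sum_connection\<close>). It too follows by comparing
  three-term recurrences.

  Substituting the second expansion into the first gives a double series over \<open>m\<close> and \<open>k\<close>. It converges
  absolutely: \<open>q\<close>-shifted factorials have bounded quotients, \<open>C\<^sub>m\<close> grows at most linearly in \<open>m\<close> on
  [-1, 1], and the terms carry \<open>t ^ m (\<gamma> t\<^sup>2) ^ k\<close>. So it may be summed over \<open>k\<close> first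
  (\<open>sums_rearrange_step_pairs\<close>). Splitting each \<open>(a; q)\<^sub>m\<^sub>+\<^sub>2\<^sub>k\<close> as \<open>(a; q)\<^sub>m (a q\<^sup>m; q)\<^sub>2\<^sub>k\<close> and the last
  factor into four \<open>(\<cdot>; q)\<^sub>k\<close> with square roots as parameters turns the inner sum into the
  \<open>10\<phi>9\<close> series (\<open>phi_term\<close>).

  Throughout, \<open>z\<close> and \<open>w\<close> stand for \<open>exp (i \<theta>)\<close> and \<open>exp (- i \<theta>)\<close>, \<open>p\<close> for the square root of \<open>q\<close>, and
  \<open>b\<close> for that of \<open>\<beta>\<close>; in the telescoping argument also \<open>h = \<beta>\<close>, \<open>a = b z\<close> and \<open>c = b w\<close>, so that \<open>h = a c\<close>.
\<close>

section \<open>q-shifted factorials and basic hypergeometric series\<close>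

lemma qpoch_0 [simp]: "qpoch a q 0 = 1"
  by (simp add: qpoch_def)

lemma qpoch_Suc [simp]: "qpoch a q (Suc n) = qpoch a q n * (1 - a * q ^ n)"
  by (simp add: qpoch_def)

lemma one_minus_mult_power_neq_0:
  fixes a q :: complex
  assumes "cmod a < 1" "cmod q < 1"
  shows "1 - a * q ^ n \<noteq> 0"
proof
  assume "1 - a * q ^ n = 0"
  then have "cmod a * cmod q ^ n = 1"
    by (metis eq_iff_diff_eq_0 norm_mult norm_one norm_power)
  moreover have "cmod a * cmod q ^ n \<le> cmod a * 1"
    using assms by (intro mult_left_mono power_le_one) auto
  ultimately show False
    using assms by simp
qed

lemma qpoch_neq_0:
  assumes "cmod a < 1" "cmod q < 1"
  shows "qpoch a q n \<noteq> 0"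
  by (induction n) (use one_minus_mult_power_neq_0[OF assms] in auto)

lemma qpoch_add: "qpoch a q (m + n) = qpoch a q m * qpoch (a * q ^ m) q n"
  by (induction n) (simp_all add: power_add algebra_simps)

lemma qpoch_minus_mult: "qpoch a q n * qpoch (- a) q n = qpoch (a\<^sup>2) (q\<^sup>2) n"
proof (induction n)
  case (Suc n)
  have "(1 - a * q ^ n) * (1 - (- a) * q ^ n) = 1 - a\<^sup>2 * (q\<^sup>2) ^ n"
    by (simp add: power2_eq_square power_mult_distrib algebra_simps flip: power_mult)
  then show ?case
    using Suc by (simp add: mult.assoc mult.left_commute)
qed simp

lemma qpoch_even_odd: "qpoch a (q\<^sup>2) n * qpoch (a * q) (q\<^sup>2) n = qpoch a q (2 * n)"
  by (induction n) (simp_all add: power_mult[symmetric] algebra_simps)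

text \<open>
  The infinite product converges absolutely, and its limit is nonzero when no factor vanishes.
\<close>

lemma qpoch_LIMSEQ:
  assumes "cmod q < 1"
  obtains L where "qpoch a q \<longlonglongrightarrow> L" "cmod a < 1 \<Longrightarrow> L \<noteq> 0"
proof -
  have "summable (\<lambda>j. norm (a * q ^ j))"
    using assms by (simp add: norm_mult norm_power summable_mult)
  then have conv: "convergent_prod (\<lambda>j. 1 - a * q ^ j)"
    by (intro abs_convergent_prod_imp_convergent_prod)
       (simp add: abs_convergent_prod_conv_summable)
  define L where "L = prodinf (\<lambda>j. 1 - a * q ^ j)"
  have "(\<lambda>n. qpoch a q (Suc n)) \<longlonglongrightarrow> L"
    using convergent_prod_LIMSEQ[OF conv] by (simp only: qpoch_def lessThan_Suc_atMost L_def)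
  then have "qpoch a q \<longlonglongrightarrow> L" by (rule LIMSEQ_imp_Suc)
  moreover have "L \<noteq> 0" if "cmod a < 1"
    unfolding L_def by (intro prodinf_nonzero conv one_minus_mult_power_neq_0 that assms)
  ultimately show ?thesis using that by blast
qed

lemma qpoch_quotient_bounded:
  assumes "cmod b < 1" "cmod q < 1"
  obtains K where "K > 0" "\<And>n. cmod (qpoch a q n / qpoch b q n) \<le> K"
proof -
  obtain L L' where "qpoch a q \<longlonglongrightarrow> L" "qpoch b q \<longlonglongrightarrow> L'" "L' \<noteq> 0"
    using qpoch_LIMSEQ[OF assms(2)] assms(1) by metis
  then have "(\<lambda>n. qpoch a q n / qpoch b q n) \<longlonglongrightarrow> L / L'"
    by (intro tendsto_divide)
  then have "Bseq (\<lambda>n. qpoch a q n / qpoch b q n)"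
    by (intro convergent_imp_Bseq convergentI)
  then show ?thesis using that by (auto elim: BseqE)
qed

text \<open>
  With one more upper than lower parameter, the power of \<open>(-1) ^ k * q ^ (k choose 2)\<close> has exponent 0.
  Every series considered here is of this kind.
\<close>

lemma qphi_balanced_length:
  assumes "length as = Suc (length bs)"
  shows "qphi as bs q z = (\<Sum>k. qpochs as q k / qpochs (q # bs) q k * z ^ k)"
  using assms by (simp add: qphi_def)

lemma qpochs_Nil [simp]: "qpochs [] q n = 1"
  and qpochs_Cons [simp]: "qpochs (a # as) q n = qpoch a q n * qpochs as q n"
  and qpochs_append [simp]: "qpochs (as @ bs) q n = qpochs as q n * qpochs bs q n"
  by (simp_all add: qpochs_def)

lemma qpochs_pm: "qpochs (pm a) q k = qpoch (a\<^sup>2) (q\<^sup>2) k"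
  by (simp add: pm_def qpoch_minus_mult)

text \<open>
  Four \<open>q\<close>-shifted factorials of length \<open>k\<close> recombine: opposite parameters give base \<open>q\<^sup>2\<close>, and the two
  results interleave to one factorial of length \<open>2 k\<close>, which continues \<open>(x; q)\<^sub>n\<close>. This is how the square
  roots enter the parameters of the \<open>10\<phi>9\<close> series.
\<close>

lemma qpochs_pm_pm:
  assumes "A\<^sup>2 = x * q ^ n" "B\<^sup>2 = A\<^sup>2 * q" and nz: "qpoch x q n \<noteq> 0"
  shows "qpochs (pm A) q k * qpochs (pm B) q k = qpoch x q (n + 2 * k) / qpoch x q n"
  using nz unfolding qpochs_pm assms(2) qpoch_even_odd qpoch_add assms(1)
  by simp

section \<open>Rogers polynomials and their recurrence\<close>

text \<open>
  For \<open>z = exp (i \<theta>)\<close> and \<open>w = exp (- i \<theta>)\<close> this is the Fourier expansion of the Rogers polynomial at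
  \<open>cos \<theta>\<close>. Unlike the terminating \<open>2\<phi>1\<close> form it is symmetric in \<open>z\<close> and \<open>w\<close> by inspection, and it is
  a Cauchy product.
\<close>

definition rogers_sum :: "complex \<Rightarrow> complex \<Rightarrow> complex \<Rightarrow> complex \<Rightarrow> nat \<Rightarrow> complex" where
  "rogers_sum \<beta> q z w n =
     (\<Sum>k\<le>n. qpoch \<beta> q k / qpoch q q k * z ^ k * (qpoch \<beta> q (n - k) / qpoch q q (n - k) * w ^ (n - k)))"

lemma rogers_sum_0 [simp]: "rogers_sum \<beta> q z w 0 = 1"
  by (simp add: rogers_sum_def)

lemma rogers_sum_1: "rogers_sum \<beta> q z w (Suc 0) = (1 - \<beta>) / (1 - q) * (z + w)"
  by (simp add: rogers_sum_def atMost_Suc algebra_simps diff_divide_distrib add_divide_distrib)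

lemma rogers_sum_commute: "rogers_sum \<beta> q w z n = rogers_sum \<beta> q z w n"
  unfolding rogers_sum_def
  by (rule sum.reindex_bij_witness[of _ "\<lambda>k. n - k" "\<lambda>k. n - k"]) (auto simp: mult_ac)

text \<open>
  The generating function of the polynomials is \<open>A z * A w\<close>, where \<open>A y\<close> is the power series in
  \<open>X\<close> with coefficients \<open>(\<beta>; q)\<^sub>n / (q; q)\<^sub>n y ^ n\<close>. The first-order \<open>q\<close>-difference equation of \<open>A y\<close>
  (\<open>X \<mapsto> q X\<close> amounts to \<open>y \<mapsto> q y\<close>) gives one for the product, with quadratic coefficients in \<open>X\<close>;
  comparing coefficients yields the recurrence.
\<close>

lemma rogers_sum_recurrence:
  assumes zw: "z * w = 1" and q: "cmod q < 1"
  shows "(1 - q ^ (n + 2)) * rogers_sum \<beta> q z w (n + 2) =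
    (z + w) * (1 - \<beta> * q ^ (n + 1)) * rogers_sum \<beta> q z w (n + 1)
    - (1 - \<beta>\<^sup>2 * q ^ n) * rogers_sum \<beta> q z w n"
proof -
  define r where "r = (\<lambda>n. qpoch \<beta> q n / qpoch q q n)"
  define A where "A = (\<lambda>y. Abs_fps (\<lambda>n. r n * y ^ n))"
  have r_Suc: "r (Suc m) * (1 - q ^ Suc m) = r m * (1 - \<beta> * q ^ m)" for m
  proof -
    have "1 - q * q ^ m \<noteq> 0"
      by (rule one_minus_mult_power_neq_0[OF q q])
    then show ?thesis by (simp add: r_def)
  qed
  have funeq: "(1 - fps_const (\<beta> * y) * fps_X) * A (q * y) = (1 - fps_const y * fps_X) * A y" for y
  proof (rule fps_ext)
    fix n
    have lin: "fps_nth ((1 - fps_const c * fps_X) * F) (Suc m) = fps_nth F (Suc m) - c * fps_nth F m"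
      for c m and F :: "complex fps"
      by (simp add: left_diff_distrib mult.assoc)
    show "fps_nth ((1 - fps_const (\<beta> * y) * fps_X) * A (q * y)) n
        = fps_nth ((1 - fps_const y * fps_X) * A y) n"
    proof (cases n)
      case 0
      then show ?thesis by (simp add: A_def)
    next
      case (Suc m)
      have "r (Suc m) * (q * y) ^ Suc m - \<beta> * y * (r m * (q * y) ^ m)
          - (r (Suc m) * y ^ Suc m - y * (r m * y ^ m))
        = - (y ^ Suc m) * (r (Suc m) * (1 - q ^ Suc m) - r m * (1 - \<beta> * q ^ m))"
        by (simp add: power_mult_distrib algebra_simps)
      also have "\<dots> = 0" by (simp only: r_Suc) simp
      finally show ?thesis
        unfolding Suc lin by (simp add: A_def)
    qed
  qed
  define C E where "C = Abs_fps (rogers_sum \<beta> q z w)"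
    and "E = Abs_fps (\<lambda>n. q ^ n * rogers_sum \<beta> q z w n)"
  have C: "A z * A w = C"
    by (rule fps_ext) (simp add: A_def r_def C_def fps_mult_nth rogers_sum_def atLeast0AtMost)
  have E: "A (q * z) * A (q * w) = E"
  proof (rule fps_ext)
    fix n
    have "q ^ n = q ^ k * q ^ (n - k)" if "k \<le> n" for k
      using that by (simp flip: power_add)
    then show "fps_nth (A (q * z) * A (q * w)) n = fps_nth E n"
      by (auto simp: A_def r_def E_def fps_mult_nth rogers_sum_def atLeast0AtMost sum_distrib_left
            power_mult_distrib intro!: sum.cong)
  qed
  have quadratic: "(1 - fps_const x * fps_X) * (1 - fps_const y * fps_X)
      = 1 - fps_const (x + y) * fps_X + fps_const (x * y) * fps_X * fps_X" for x y :: complex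
    unfolding fps_const_add[symmetric] fps_const_mult[symmetric] by (simp add: algebra_simps)
  have "(1 - fps_const (\<beta> * z) * fps_X) * (1 - fps_const (\<beta> * w) * fps_X) * E
      = (1 - fps_const z * fps_X) * (1 - fps_const w * fps_X) * C"
    unfolding C[symmetric] E[symmetric] using arg_cong2[OF funeq[of z] funeq[of w], of "(*)"]
    by (simp only: mult_ac)
  also have "(1 - fps_const z * fps_X) * (1 - fps_const w * fps_X)
      = 1 - fps_const (z + w) * fps_X + fps_X * fps_X"
    using quadratic[of z w] by (simp add: zw)
  also have "(1 - fps_const (\<beta> * z) * fps_X) * (1 - fps_const (\<beta> * w) * fps_X)
      = 1 - fps_const (\<beta> * (z + w)) * fps_X + fps_const (\<beta>\<^sup>2) * fps_X * fps_X"
  proof -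
    have "\<beta> * z * (\<beta> * w) = \<beta>\<^sup>2" "\<beta> * z + \<beta> * w = \<beta> * (z + w)"
      using zw by (simp_all add: power2_eq_square ring_distribs)
    with quadratic[of "\<beta> * z" "\<beta> * w"] show ?thesis by simp
  qed
  finally have "(1 - fps_const (\<beta> * (z + w)) * fps_X + fps_const (\<beta>\<^sup>2) * fps_X * fps_X) * E
      = (1 - fps_const (z + w) * fps_X + fps_X * fps_X) * C" .
  from arg_cong[OF this, of "\<lambda>f. fps_nth f (n + 2)"]
  have "q ^ (n + 2) * rogers_sum \<beta> q z w (n + 2) - \<beta> * (z + w) * (q ^ (n + 1) * rogers_sum \<beta> q z w (n + 1))
      + \<beta>\<^sup>2 * (q ^ n * rogers_sum \<beta> q z w n)
    = rogers_sum \<beta> q z w (n + 2) - (z + w) * rogers_sum \<beta> q z w (n + 1) + rogers_sum \<beta> q z w n"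
    by (simp add: C_def E_def ring_distribs mult.assoc fps_mult_left_const_nth numeral_2_eq_2)
  then show ?thesis
    by (simp add: algebra_simps)
qed

lemma rogers_sum_unique:
  assumes zw: "z * w = 1" and q: "cmod q < 1"
    and f0: "f 0 = 1" and f1: "(1 - q) * f (Suc 0) = (z + w) * (1 - \<beta>)"
    and rec: "\<And>n. (1 - q ^ (n + 2)) * f (n + 2) =
      (z + w) * (1 - \<beta> * q ^ (n + 1)) * f (n + 1) - (1 - \<beta>\<^sup>2 * q ^ n) * f n"
  shows "f n = rogers_sum \<beta> q z w n"
proof (induction n rule: induct_nat_012)
  case 0
  then show ?case using f0 by simp
next
  case 1
  have "1 - q \<noteq> 0" using q by auto
  then show ?case using f1 by (simp add: rogers_sum_1 field_simps)
next
  case (ge2 n)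
  have "1 - q ^ (n + 2) \<noteq> 0"
    using one_minus_mult_power_neq_0[OF q q, of "n + 1"] by simp
  moreover have "(1 - q ^ (n + 2)) * f (n + 2) = (1 - q ^ (n + 2)) * rogers_sum \<beta> q z w (n + 2)"
    using ge2 unfolding rec rogers_sum_recurrence[OF zw q] by simp
  ultimately show ?case by simp
qed

lemma qpoch_powi_neg_eq_0:
  assumes "q \<noteq> 0" "n < k"
  shows "qpoch (q powi (- int n)) q k = 0"
proof -
  have "1 - q powi (- int n) * q ^ n = 0"
    using assms by (simp add: power_int_minus)
  then show ?thesis
    using assms by (auto simp: qpoch_def)
qed

text \<open>
  Reversing \<open>k\<close> factors of \<open>(\<gamma>; q)\<^sub>n / (q; q)\<^sub>n\<close> produces the factorials with parameters \<open>q ^ (- n)\<close> and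
  \<open>\<gamma> ^ (- 1) q ^ (1 - n)\<close>; the factor \<open>q / \<gamma>\<close> collects what the reversal leaves over.
\<close>

lemma rogers_term:
  assumes \<gamma>: "cmod \<gamma> < 1" "\<gamma> \<noteq> 0" and q: "cmod q < 1" "q \<noteq> 0" and "k \<le> n"
  shows "qpoch \<gamma> q n / qpoch q q n * (qpoch (q powi (- int n)) q k / qpoch (inverse \<gamma> * q powi (1 - int n)) q k)
      * (q * inverse \<gamma>) ^ k = qpoch \<gamma> q (n - k) / qpoch q q (n - k)"
  using \<open>k \<le> n\<close>
proof (induction k)
  case (Suc k)
  define j where "j = n - Suc k"
  have j: "n - k = Suc j" "n = Suc j + k" using Suc.prems by (auto simp: j_def)
  define A B where "A = 1 - \<gamma> * q ^ j" and "B = 1 - q * q ^ j"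
  have AB: "A \<noteq> 0" "B \<noteq> 0"
    unfolding A_def B_def by (rule one_minus_mult_power_neq_0[OF \<gamma>(1) q(1)] one_minus_mult_power_neq_0[OF q(1) q(1)])+
  have 1: "1 - q powi (- int n) * q ^ k = - B / q ^ Suc j"
  proof -
    have pw: "q powi (- int n) = 1 / (q ^ Suc j * q ^ k)"
      by (simp only: power_int_minus power_int_of_nat j(2) power_add inverse_eq_divide)
    have "1 - 1 / (X * K) * K = - (1 - X) / X" if "X \<noteq> 0" "K \<noteq> 0" for X K :: complex
      using that by (simp add: divide_simps)
    from this[of "q ^ Suc j" "q ^ k"] q show ?thesis
      unfolding pw B_def power_Suc[symmetric] by (simp only: power_not_zero simp_thms)
  qed
  have "q powi (1 - int n) = q / q ^ n"
    using q by (simp add: power_int_diff)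
  then have 2: "1 - inverse \<gamma> * q powi (1 - int n) * q ^ k = - A / (\<gamma> * q ^ j)"
    using q \<gamma> unfolding A_def j by (simp add: power_add field_simps)
  have "qpoch \<gamma> q n / qpoch q q n * (qpoch (q powi (- int n)) q (Suc k) / qpoch (inverse \<gamma> * q powi (1 - int n)) q (Suc k))
      * (q * inverse \<gamma>) ^ Suc k
    = qpoch \<gamma> q (n - k) / qpoch q q (n - k) * ((- B / q ^ Suc j) / (- A / (\<gamma> * q ^ j)) * (q * inverse \<gamma>))"
  proof -
    have "(q * inverse \<gamma>) ^ Suc k = (q * inverse \<gamma>) ^ k * (q * inverse \<gamma>)" by simp
    then show ?thesis
      unfolding qpoch_Suc 1 2 Suc.IH[OF Suc_leD[OF Suc.prems], symmetric]
      by (simp only: times_divide_times_eq[symmetric] mult_ac)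
  qed
  also have "\<dots> = qpoch \<gamma> q (n - k) / qpoch q q (n - k) * (B / A)"
    using q \<gamma> by (simp add: field_simps)
  also have "\<dots> = qpoch \<gamma> q j / qpoch q q j"
    using AB unfolding j(1) by (simp add: A_def[symmetric] B_def[symmetric])
  finally show ?case by (simp add: j_def)
qed simp

text \<open>
  The principal arccosine \<open>\<phi>\<close> of \<open>cos \<theta>\<close> can differ from \<open>\<theta>\<close>, but \<open>cos \<phi> = cos \<theta>\<close> forces \<open>exp (i \<phi>)\<close> to be
  \<open>exp (i \<theta>)\<close> or its inverse, and the symmetric sum does not distinguish them.
\<close>

lemma rogers_C_eq_rogers_sum:
  assumes \<gamma>: "cmod \<gamma> < 1" "\<gamma> \<noteq> 0" and q: "cmod q < 1" "q \<noteq> 0"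
  shows "rogers_C n (cos \<theta>) \<gamma> q = rogers_sum \<gamma> q (exp (\<i> * \<theta>)) (exp (- \<i> * \<theta>)) n"
proof -
  define \<phi> where "\<phi> = Arccos (cos \<theta>)"
  define v u z w where "v = exp (\<i> * \<phi>)" and "u = exp (- (\<i> * \<phi>))"
    and "z = exp (\<i> * \<theta>)" and "w = exp (- (\<i> * \<theta>))"
  have vu: "u * v = 1" and zw: "z * w = 1"
    by (simp_all add: v_def u_def z_def w_def flip: exp_add)
  have "rogers_C n (cos \<theta>) \<gamma> q = qpoch \<gamma> q n / qpoch q q n * v ^ n
      * qphi [q powi (- int n), \<gamma>] [inverse \<gamma> * q powi (1 - int n)] q (q * inverse \<gamma> * u\<^sup>2)"
    by (simp add: rogers_C_def Let_def \<phi>_def[symmetric] v_def u_def mult_ac flip: exp_of_nat_mult)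
  also have "qphi [q powi (- int n), \<gamma>] [inverse \<gamma> * q powi (1 - int n)] q (q * inverse \<gamma> * u\<^sup>2)
      = (\<Sum>k\<le>n. qpoch (q powi (- int n)) q k * qpoch \<gamma> q k
          / (qpoch q q k * qpoch (inverse \<gamma> * q powi (1 - int n)) q k) * (q * inverse \<gamma> * u\<^sup>2) ^ k)"
    unfolding qphi_balanced_length[of "[_, _]" "[_]", simplified]
    by (subst suminf_finite[of "{..n}"]) (auto simp: qpoch_powi_neg_eq_0[OF q(2)])
  also have "qpoch \<gamma> q n / qpoch q q n * v ^ n * \<dots> = rogers_sum \<gamma> q u v n"
    unfolding rogers_sum_def sum_distrib_left
  proof (intro sum.cong refl)
    fix k assume "k \<in> {..n}"
    then have k: "k \<le> n" by simp
    have "v ^ n * (u\<^sup>2) ^ k = (u * v) ^ k * (u ^ k * v ^ (n - k))"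
      using k by (simp add: power_mult_distrib power2_eq_square flip: power_add)
         (simp add: mult.left_commute mult.assoc flip: power_add)
    then have vk: "v ^ n * (u\<^sup>2) ^ k = u ^ k * v ^ (n - k)" by (simp add: vu)
    have "qpoch \<gamma> q n / qpoch q q n * v ^ n * (qpoch (q powi (- int n)) q k * qpoch \<gamma> q k
          / (qpoch q q k * qpoch (inverse \<gamma> * q powi (1 - int n)) q k) * (q * inverse \<gamma> * u\<^sup>2) ^ k)
      = (qpoch \<gamma> q n / qpoch q q n * (qpoch (q powi (- int n)) q k / qpoch (inverse \<gamma> * q powi (1 - int n)) q k)
        * (q * inverse \<gamma>) ^ k) * (qpoch \<gamma> q k / qpoch q q k) * (v ^ n * (u\<^sup>2) ^ k)"
      unfolding power_mult_distrib[of "q * inverse \<gamma>"] by (simp add: mult_ac)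
    then show "qpoch \<gamma> q n / qpoch q q n * v ^ n * (qpoch (q powi (- int n)) q k * qpoch \<gamma> q k
          / (qpoch q q k * qpoch (inverse \<gamma> * q powi (1 - int n)) q k) * (q * inverse \<gamma> * u\<^sup>2) ^ k)
      = qpoch \<gamma> q k / qpoch q q k * u ^ k * (qpoch \<gamma> q (n - k) / qpoch q q (n - k) * v ^ (n - k))"
      unfolding rogers_term[OF \<gamma> q k] vk by (simp add: mult_ac)
  qed
  also have "\<dots> = rogers_sum \<gamma> q z w n"
  proof -
    have "exp (\<i> * x) + exp (- (\<i> * x)) = 2 * cos x" for x :: complex
      by (simp add: cos_exp_eq)
    then have sum_eq: "v + u = z + w"
      unfolding v_def u_def z_def w_def by (simp add: \<phi>_def)
    have "(v - z) * (v - w) = v * v - v * (z + w) + z * w"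
      by (simp add: algebra_simps)
    also have "\<dots> = 0"
      unfolding sum_eq[symmetric] zw vu[symmetric] by (simp add: algebra_simps)
    finally have "(v - z) * (v - w) = 0" .
    then consider "v = z" | "v = w" by auto
    then show ?thesis
    proof cases
      case 1
      then have "u = w" using sum_eq by simp
      with 1 show ?thesis by (simp add: rogers_sum_commute)
    next
      case 2
      then have "u = z" using sum_eq by simp
      with 2 show ?thesis by simp
    qed
  qed
  finally show ?thesis by (simp add: z_def w_def)
qed

section \<open>The connection formula\<close>

definition connection_coeff :: "complex \<Rightarrow> complex \<Rightarrow> complex \<Rightarrow> nat \<Rightarrow> nat \<Rightarrow> complex" where
  "connection_coeff \<beta> \<gamma> q m k =
     \<gamma> ^ k * qpoch (\<beta> / \<gamma>) q k * qpoch \<beta> q (m + k) / (qpoch q q k * qpoch (\<gamma> * q) q (m + k))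
       * (1 - \<gamma> * q ^ m) / (1 - \<gamma>)"

text \<open>
  Rogers polynomials are even or odd functions of \<open>x\<close> according to the parity of the degree, so the expansion
  of \<open>C\<^sub>n(x; \<beta>|q)\<close> involves only the degrees \<open>m = n - 2 k\<close>.
\<close>

definition step_pairs :: "nat \<Rightarrow> (nat \<times> nat) set" where
  "step_pairs n = {(m, k). m + 2 * k = n}"

lemma finite_step_pairs [simp]: "finite (step_pairs n)"
  by (rule finite_subset[of _ "{..n} \<times> {..n}"]) (auto simp: step_pairs_def)

text \<open>
  The next three lemmas move sums over neighbouring antidiagonals to a common one, so that the recurrence
  can be compared term by term. The conditionals record the boundary points without a preimage.
\<close>

lemma sum_step_pairs_shift_fst:
  "(\<Sum>(m, k)\<in>step_pairs n. f (Suc m) k) = (\<Sum>(m, k)\<in>step_pairs (Suc n). if m = 0 then 0 else f m k)"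
proof -
  have "(\<Sum>(m, k)\<in>step_pairs (Suc n). if m = 0 then 0 else f m k)
      = (\<Sum>(m, k)\<in>{x \<in> step_pairs (Suc n). fst x \<noteq> 0}. f m k)"
    by (subst sum.inter_filter) (auto intro!: sum.cong)
  also have "\<dots> = (\<Sum>(m, k)\<in>step_pairs n. f (Suc m) k)"
    by (rule sum.reindex_bij_witness[of _ "\<lambda>(m, k). (Suc m, k)" "\<lambda>(m, k). (m - 1, k)"])
       (auto simp: step_pairs_def)
  finally show ?thesis ..
qed

lemma sum_step_pairs_shift_snd:
  "(\<Sum>(m, k)\<in>step_pairs n. f m (Suc k)) = (\<Sum>(m, k)\<in>step_pairs (n + 2). if k = 0 then 0 else f m k)"
proof -
  have "(\<Sum>(m, k)\<in>step_pairs (n + 2). if k = 0 then 0 else f m k)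
      = (\<Sum>(m, k)\<in>{x \<in> step_pairs (n + 2). snd x \<noteq> 0}. f m k)"
    by (subst sum.inter_filter) (auto intro!: sum.cong)
  also have "\<dots> = (\<Sum>(m, k)\<in>step_pairs n. f m (Suc k))"
    by (rule sum.reindex_bij_witness[of _ "\<lambda>(m, k). (m, Suc k)" "\<lambda>(m, k). (m, k - 1)"])
       (auto simp: step_pairs_def)
  finally show ?thesis ..
qed

lemma sum_step_pairs_shift_down:
  assumes "\<And>k. f 0 k = 0"
  shows "(\<Sum>(m, k)\<in>step_pairs (Suc n). f m k) = (\<Sum>(m, k)\<in>step_pairs (n + 2). if k = 0 then 0 else f (Suc m) (k - 1))"
proof -
  have "(\<Sum>(m, k)\<in>step_pairs (n + 2). if k = 0 then 0 else f (Suc m) (k - 1)) = (\<Sum>(m, k)\<in>step_pairs n. f (Suc m) k)"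
    using sum_step_pairs_shift_snd[of "\<lambda>m k. f (Suc m) (k - 1)" n] by simp
  also have "\<dots> = (\<Sum>(m, k)\<in>step_pairs (Suc n). f m k)"
    unfolding sum_step_pairs_shift_fst[of f] using assms by (intro sum.cong) auto
  finally show ?thesis ..
qed

text \<open>
  This is the coefficient of \<open>C\<^sub>m(x; \<gamma>|q)\<close> when the connection formula is inserted in the recurrence for
  parameter \<open>\<beta>\<close> and \<open>2 x C\<^sub>m\<close> is expanded by the recurrence for parameter \<open>\<gamma>\<close>. All the coefficients
  that occur are polynomial multiples of one common factor \<open>e\<close>, so a polynomial identity in \<open>q ^ m\<close> and
  \<open>q ^ k\<close> remains.
\<close>

lemma connection_coeff_recurrence:
  fixes \<beta> \<gamma> q :: complex and m k :: nat
  assumes \<gamma>: "cmod \<gamma> < 1" "\<gamma> \<noteq> 0" and q: "cmod q < 1" and n: "m + 2 * k = n + 2"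
  defines "d \<equiv> connection_coeff \<beta> \<gamma> q" and "d' \<equiv> \<lambda>m k. connection_coeff \<beta> \<gamma> q m k / (1 - \<gamma> * q ^ m)"
  shows "(1 - \<beta> * q ^ (n + 1)) * ((if m = 0 then 0 else d' (m - 1) k * (1 - q ^ m))
           + (if k = 0 then 0 else d' (m + 1) (k - 1) * (1 - \<gamma>\<^sup>2 * q ^ m)))
       = (1 - q ^ (n + 2)) * d m k + (1 - \<beta>\<^sup>2 * q ^ n) * (if k = 0 then 0 else d m (k - 1))"
proof -
  have \<gamma>q: "cmod (\<gamma> * q) < 1"
    using mult_strict_mono'[of "cmod \<gamma>" 1 "cmod q" 1] \<gamma> q by (simp add: norm_mult)
  note nz = one_minus_mult_power_neq_0[OF \<gamma>(1) q] one_minus_mult_power_neq_0[OF q q]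
    one_minus_mult_power_neq_0[OF \<gamma>q q] qpoch_neq_0[OF q q] qpoch_neq_0[OF \<gamma>q q]
  have nz': "1 - \<gamma> \<noteq> 0" using nz(1)[of 0] by simp
  \<comment> \<open>The factor \<open>1 - \<gamma> * q ^ m\<close> of the coefficient cancels in \<open>d'\<close>, leaving \<open>core\<close>.\<close>
  define core where "core = (\<lambda>m k. \<gamma> ^ k * qpoch (\<beta> / \<gamma>) q k * qpoch \<beta> q (m + k)
    / (qpoch q q k * qpoch (\<gamma> * q) q (m + k)) / (1 - \<gamma>))"
  have d: "d m k = core m k * (1 - \<gamma> * q ^ m)" and d': "d' m k = core m k" for m k
    using nz(1)[of m] by (simp_all add: d_def d'_def core_def connection_coeff_def mult.assoc)
  consider (m0) k' where "m = 0" "k = Suc k'" | (k0) m' where "k = 0" "m = Suc m'"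
    | (both) m' k' where "m = Suc m'" "k = Suc k'"
    using n by (cases m; cases k) auto
  then show ?thesis
  proof cases
    case m0
    have n': "n = 2 * k'" using n m0 by simp
    define K where "K = q ^ k'"
    define e where "e = \<gamma> ^ k' * qpoch (\<beta> / \<gamma>) q k' * qpoch \<beta> q k'
      / (qpoch q q (Suc k') * qpoch (\<gamma> * q) q (Suc k')) / (1 - \<gamma>)"
    have a: "core 1 k' = e * (1 - \<beta> * K) * (1 - q * K)"
      using nz nz' unfolding core_def e_def K_def by (simp add: divide_simps power_add power2_eq_square)
    have b: "core 0 k = e * (\<gamma> - \<beta> * K) * (1 - \<beta> * K)"
      using nz nz' \<gamma>(2) unfolding core_def e_def K_def m0 by (simp add: divide_simps power_add power2_eq_square)
    have c: "core 0 k' = e * (1 - q * K) * (1 - \<gamma> * q * K)"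
      using nz nz' unfolding core_def e_def K_def by (simp add: divide_simps power_add power2_eq_square)
    have pw: "q ^ (n + 1) = q * K\<^sup>2" "q ^ (n + 2) = q\<^sup>2 * K\<^sup>2" "q ^ n = K\<^sup>2"
      by (simp_all add: n' K_def power_add power2_eq_square power_mult_distrib flip: power_mult)
         (simp_all add: mult_2 power_add)
    have "(1 - \<beta> * (q * K\<^sup>2)) * (d' 1 k' * (1 - \<gamma>\<^sup>2))
       = (1 - q\<^sup>2 * K\<^sup>2) * d 0 k + (1 - \<beta>\<^sup>2 * K\<^sup>2) * d 0 k'"
      unfolding d d' a b c power_0 by algebra
    then show ?thesis
      unfolding pw using m0 by simp
  next
    case k0
    have n': "n + 1 = m'" using n k0 by simp
    have "core m 0 * (1 - \<gamma> * q ^ m) = (1 - \<beta> * q ^ m') * core m' 0"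
      using nz nz' unfolding core_def k0 by (simp add: divide_simps)
    then have "d m 0 = (1 - \<beta> * q ^ m') * d' m' 0"
      unfolding d d' .
    moreover have "n + 2 = m" using n k0 by simp
    ultimately show ?thesis
      unfolding n' using k0 by simp
  next
    case both
    have n': "n = m' + 2 * k' + 1" using n both by simp
    define M K where "M = q ^ m'" and "K = q ^ k'"
    define e where "e = \<gamma> ^ k' * qpoch (\<beta> / \<gamma>) q k' * qpoch \<beta> q (m' + k' + 1)
      / (qpoch q q (Suc k') * qpoch (\<gamma> * q) q (m' + k' + 2)) / (1 - \<gamma>)"
    have nz2: "1 - \<gamma> * q * (q ^ m' * q ^ k') \<noteq> 0" "1 - \<gamma> * q * (q * (q ^ m' * q ^ k')) \<noteq> 0"
      using nz(3)[of "m' + k'"] nz(3)[of "m' + k' + 1"] by (simp_all add: power_add)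
    have a: "core m' k = e * (\<gamma> - \<beta> * K) * (1 - \<gamma> * q\<^sup>2 * (M * K))"
      using nz nz2 nz' \<gamma>(2) unfolding core_def e_def M_def K_def both by (simp add: divide_simps power_add power2_eq_square mult.assoc)
    have b: "core (m + 1) k' = e * (1 - \<beta> * q * M * K) * (1 - q * K)"
      using nz nz2 nz' unfolding core_def e_def M_def K_def both by (simp add: divide_simps power_add power2_eq_square mult.assoc)
    have c: "core m k = e * (\<gamma> - \<beta> * K) * (1 - \<beta> * q * M * K)"
      using nz nz2 nz' \<gamma>(2) unfolding core_def e_def M_def K_def both by (simp add: divide_simps power_add power2_eq_square mult.assoc)
    have e: "core m k' = e * (1 - q * K) * (1 - \<gamma> * q\<^sup>2 * (M * K))"
      using nz nz2 nz' unfolding core_def e_def M_def K_def both by (simp add: divide_simps power_add power2_eq_square mult.assoc)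
    have pw: "q ^ (n + 1) = q\<^sup>2 * M * K\<^sup>2" "q ^ (n + 2) = q^3 * M * K\<^sup>2" "q ^ n = q * M * K\<^sup>2" "q ^ m = q * M"
      by (simp_all add: n' both M_def K_def power_add power2_eq_square power3_eq_cube mult_2)
    have "(1 - \<beta> * (q\<^sup>2 * M * K\<^sup>2)) * (d' m' k * (1 - q * M) + d' (m + 1) k' * (1 - \<gamma>\<^sup>2 * (q * M)))
       = (1 - q^3 * M * K\<^sup>2) * d m k + (1 - \<beta>\<^sup>2 * (q * M * K\<^sup>2)) * d m k'"
      unfolding d d' a b c e pw by algebra
    then show ?thesis
      unfolding pw using both by simp
  qed
qed

text \<open>
  The right-hand side satisfies the recurrence and the initial conditions that determine the Rogers
  polynomials with parameter \<open>\<beta>\<close>.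
\<close>

theorem rogers_sum_connection:
  fixes \<beta> \<gamma> q :: complex
  assumes zw: "z * w = 1" and \<gamma>: "cmod \<gamma> < 1" "\<gamma> \<noteq> 0" and q: "cmod q < 1"
  shows "rogers_sum \<beta> q z w n
    = (\<Sum>(m, k)\<in>step_pairs n. connection_coeff \<beta> \<gamma> q m k * rogers_sum \<gamma> q z w m)"
proof -
  define C d d' where "C = rogers_sum \<gamma> q z w" and "d = connection_coeff \<beta> \<gamma> q"
    and "d' = (\<lambda>m k. connection_coeff \<beta> \<gamma> q m k / (1 - \<gamma> * q ^ m))"
  define E where "E = (\<lambda>n. \<Sum>(m, k)\<in>step_pairs n. d m k * C m)"
  have nz: "1 - \<gamma> * q ^ m \<noteq> 0" for m
    by (rule one_minus_mult_power_neq_0[OF \<gamma>(1) q])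
  have nz1: "1 - \<gamma> \<noteq> 0" "1 - \<gamma> * q \<noteq> 0" "1 - q \<noteq> 0"
    using nz[of 0] nz[of 1] q by auto
  have C_mult: "(z + w) * C m = ((1 - q ^ Suc m) * C (Suc m)
      + (case m of 0 \<Rightarrow> 0 | Suc i \<Rightarrow> (1 - \<gamma>\<^sup>2 * q ^ i) * C i)) / (1 - \<gamma> * q ^ m)" for m
  proof (cases m)
    case 0
    then show ?thesis using nz1 by (simp add: C_def rogers_sum_1)
  next
    case (Suc i)
    have "(z + w) * C m * (1 - \<gamma> * q ^ m) = (1 - q ^ Suc m) * C (Suc m) + (1 - \<gamma>\<^sup>2 * q ^ i) * C i"
      using rogers_sum_recurrence[OF zw q, of i \<gamma>] unfolding Suc C_def
      by (simp add: algebra_simps)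
    then show ?thesis using nz[of m] unfolding Suc by (simp add: eq_divide_eq)
  qed
  have "E n = rogers_sum \<beta> q z w n"
  proof (rule rogers_sum_unique[OF zw q])
    have "step_pairs 0 = {(0, 0)}" "step_pairs (Suc 0) = {(Suc 0, 0)}"
      by (auto simp: step_pairs_def; presburger)+
    then show "E 0 = 1" "(1 - q) * E (Suc 0) = (z + w) * (1 - \<beta>)"
      using nz1 by (simp_all add: E_def C_def d_def connection_coeff_def rogers_sum_1)
    fix n
    define B where "B = 1 - \<beta> * q ^ (n + 1)"
    \<comment> \<open>The contributions of \<open>C (m + 1)\<close>, \<open>C (m - 1)\<close> and of the lower level, moved to the antidiagonal \<open>n + 2\<close>.\<close>
    define up down low where "up = (\<lambda>m k. if m = 0 then 0 else d' (m - 1) k * (1 - q ^ m) * C m)"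
      and "down = (\<lambda>m k. if k = 0 then 0 else d' (m + 1) (k - 1) * (1 - \<gamma>\<^sup>2 * q ^ m) * C m)"
      and "low = (\<lambda>m k. if k = 0 then 0 else d m (k - 1) * C m)"
    have "(z + w) * (d m k * C m) = d' m k * (1 - q ^ Suc m) * C (Suc m)
        + d' m k * (case m of 0 \<Rightarrow> 0 | Suc i \<Rightarrow> (1 - \<gamma>\<^sup>2 * q ^ i) * C i)" for m k
    proof -
      have "(z + w) * (d m k * C m) = d m k * ((z + w) * C m)" by simp
      then show ?thesis
        unfolding C_mult d'_def d_def by (simp add: distrib_left add_divide_distrib mult.assoc)
    qed
    then have "(z + w) * E (n + 1) =
        (\<Sum>(m, k)\<in>step_pairs (n + 1). d' m k * (1 - q ^ Suc m) * C (Suc m))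
        + (\<Sum>(m, k)\<in>step_pairs (n + 1). d' m k * (case m of 0 \<Rightarrow> 0 | Suc i \<Rightarrow> (1 - \<gamma>\<^sup>2 * q ^ i) * C i))"
      unfolding E_def sum_distrib_left sum.distrib[symmetric] by (intro sum.cong) auto
    also have "(\<Sum>(m, k)\<in>step_pairs (n + 1). d' m k * (1 - q ^ Suc m) * C (Suc m))
        = (\<Sum>(m, k)\<in>step_pairs (n + 2). up m k)"
      using sum_step_pairs_shift_fst[of "\<lambda>m k. d' (m - 1) k * (1 - q ^ m) * C m" "n + 1"]
      by (simp add: up_def)
    also have "(\<Sum>(m, k)\<in>step_pairs (n + 1). d' m k * (case m of 0 \<Rightarrow> 0 | Suc i \<Rightarrow> (1 - \<gamma>\<^sup>2 * q ^ i) * C i))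
        = (\<Sum>(m, k)\<in>step_pairs (n + 2). down m k)"
      using sum_step_pairs_shift_down[of "\<lambda>m k. d' m k * (case m of 0 \<Rightarrow> 0 | Suc i \<Rightarrow> (1 - \<gamma>\<^sup>2 * q ^ i) * C i)" n]
      by (simp add: down_def mult.assoc cong: if_cong)
    finally have mid: "(z + w) * E (n + 1) = (\<Sum>(m, k)\<in>step_pairs (n + 2). up m k) + (\<Sum>(m, k)\<in>step_pairs (n + 2). down m k)" .
    have low: "E n = (\<Sum>(m, k)\<in>step_pairs (n + 2). low m k)"
      using sum_step_pairs_shift_snd[of "\<lambda>m k. d m (k - 1) * C m" n] by (simp add: E_def low_def)
    have "B * (up m k + down m k) = (1 - q ^ (n + 2)) * (d m k * C m) + (1 - \<beta>\<^sup>2 * q ^ n) * low m k"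
      if "(m, k) \<in> step_pairs (n + 2)" for m k
    proof -
      have "m + 2 * k = n + 2" using that by (simp add: step_pairs_def)
      from arg_cong[OF connection_coeff_recurrence[OF \<gamma> q this, of \<beta>], of "\<lambda>x. x * C m"]
      show ?thesis
        unfolding up_def down_def low_def B_def d_def d'_def
        by (cases "m = 0"; cases "k = 0") (simp_all add: algebra_simps)
    qed
    moreover have E2: "E (n + 2) = (\<Sum>(m, k)\<in>step_pairs (n + 2). d m k * C m)"
      by (simp only: E_def)
    ultimately have "B * ((z + w) * E (n + 1)) = (1 - q ^ (n + 2)) * E (n + 2) + (1 - \<beta>\<^sup>2 * q ^ n) * E n"
      unfolding mid low E2 sum_distrib_left sum.distrib[symmetric]
      by (intro sum.cong) auto
    then show "(1 - q ^ (n + 2)) * E (n + 2)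
        = (z + w) * (1 - \<beta> * q ^ (n + 1)) * E (n + 1) - (1 - \<beta>\<^sup>2 * q ^ n) * E n"
      unfolding B_def by (simp add: algebra_simps)
  qed
  then show ?thesis
    unfolding E_def C_def d_def ..
qed

section \<open>Telescoping the coefficients of the product\<close>

text \<open>
  The polynomial part of the telescoping certificate, at \<open>Q = q ^ n\<close> and \<open>W = q ^ (n - j)\<close>. Gosper's
  algorithm, applied to the sum over \<open>j\<close> with unknown recurrence coefficients, predicts a polynomial in
  \<open>W\<close> of degree 3 without constant term; comparing the powers of \<open>W\<close> gives linear equations whose
  solution this is.
\<close>

definition cert :: "complex \<Rightarrow> complex \<Rightarrow> complex \<Rightarrow> complex \<Rightarrow> complex \<Rightarrow> complex" where
 "cert a c p Q W = W * ((Q*a^2*c^2 - Q*a*c^2*p*(1+p) + Q*a*c*p - a*c*p - c*(1+p) - p^2)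
   + W * (a*c*p^3 - c^2*p + Q*a*c^2*p*(1+p+p^2+p^3) + Q*a*c^3*(1-p^2) - Q*a^2*c^2*p^2*(1-p^2)
      + Q*a^2*c^3*(1+p+p^2+p^3) + Q^2*a^2*c^4*p - Q^2*a^3*c^3*p^3)
   + W^2 * (Q*a*c^3*p^4 - Q*a^2*c^3*p^2*(1+p) + Q*a^2*c^4*p^3 - Q^2*a^2*c^4*p^3
      - Q^2*a^3*c^4*p^3*(1+p) - Q^2*a^3*c^5*p^2))"

text \<open>
  The telescoping relation for the terms of index \<open>j\<close>, divided by their common factor and multiplied by \<open>c\<close>, where
  \<open>X = q ^ j\<close>, \<open>Y = q ^ (N - j)\<close> and \<open>M = q ^ N\<close>.
\<close>

lemma step_identity:
  fixes a c p X Y :: complex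
  assumes h: "h = a*c" and q: "q = p^2" and M: "M = X*Y"
  shows "p * (a * ((1-q^2*M)*(1-h^2*q*M)*(1-h*p*q*M)*(1-h*p*M)) * ((1+c*Y)*(1+c*p*Y)*(1+c*q*Y)*(1+c*p*q*Y))
    - (a+c) * ((1-h^2*q^2*M^2)*(1+h*p*q*M)*(1-h*p*M)) * ((1+c*Y)*(1+c*p*Y)*(1-q^2*Y)*(1-h*p*q*Y))
    + c * ((1+h*M)*(1+h*p*M)*(1+h*q*M)*(1+h*p*q*M)) * ((1-q*Y)*(1-h*p*Y)*(1-q^2*Y)*(1-h*p*q*Y)))
   = p * c*(1-a*X)*(1-a*p*X)*(1-q^2*Y)*(1-h*p*q*Y)* cert a c p (q*M) Y
    - a*(1-X)*(p-h*X)*(1+c*Y)*(1+c*p*Y)* cert a c p (q*M) (q*Y)"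
  unfolding cert_def h q M by algebra

text \<open>
  The recurrence has terms with \<open>j = N + 1\<close> and \<open>j = N + 2\<close>, which the telescoping sum over \<open>j \<le> N\<close> does
  not reach. They cancel against the last value of the certificate, here with \<open>X = q ^ (N + 1)\<close>.
\<close>

lemma boundary_identity:
  fixes a c p X :: complex
  assumes h: "h = a*c" and q: "q = p^2"
  shows "(1-h^2*X) * (a*(1+c)*(1+c*p)*(1-h*p*X)*(1-q*X) + c*(1-a*X)*(1-a*p*X)*(1-q)*(1-h*p))
   - (a+c)*(1-h^2*X^2)*(1+h*p*X)*(1-q)*(1-h*p) + a*(1-X)*cert a c p X 1 = 0"
  unfolding cert_def h q by (simp only: power_one mult_1_left mult_1_right) algebra

text \<open>
  Here \<open>S n\<close> is the coefficient of \<open>t ^ n\<close> in the product of the two \<open>2\<phi>1\<close> series. The recurrence has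
  the coefficients it must have for \<open>gf_coeff h p n\<close> times the Rogers polynomial with parameter \<open>h\<close>, cleared of
  denominators. The same combination of the summands is the difference of consecutive values of \<open>G\<close> below.
\<close>

lemma generating_coeff_recurrence:
  fixes p b z w :: complex and N :: nat
  assumes zw: "z * w = 1" and b: "cmod b < 1" "b \<noteq> 0" and p: "cmod p < 1" "p \<noteq> 0"
  defines "q \<equiv> p\<^sup>2" and "h \<equiv> b\<^sup>2"
  defines "u \<equiv> \<lambda>j. qpoch (b * z) q j * qpoch (b * z * p) q j / (qpoch q q j * qpoch (h * p) q j) * w ^ j"
    and "v \<equiv> \<lambda>k. qpoch (- (b * w)) q k * qpoch (- (b * w * p)) q k / (qpoch q q k * qpoch (h * p) q k) * z ^ k"
  defines "S \<equiv> \<lambda>n. \<Sum>j\<le>n. u j * v (n - j)"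
  defines "M \<equiv> q ^ N"
  shows "(1-q^2*M)*(1-h^2*q*M)*(1-h*p*q*M)*(1-h*p*M) * S (N + 2)
    - (z + w) * ((1-h^2*q^2*M^2)*(1+h*p*q*M)*(1-h*p*M)) * S (N + 1)
    + (1+h*M)*(1+h*p*M)*(1+h*q*M)*(1+h*p*q*M) * S N = 0"
proof -
  define a c where "a = b * z" and "c = b * w"
  have h: "h = a * c" and az: "a = z * z * c"
    using zw by (simp_all add: h_def a_def c_def power2_eq_square)
  have cz: "c * z\<^sup>2 = a"
    unfolding az by (simp add: power2_eq_square)
  have "c * (z + w) * z = c * z\<^sup>2 + c * (z * w)"
    by (simp add: power2_eq_square algebra_simps)
  then have czw: "c * (z + w) * z = a + c"
    unfolding cz zw by simp
  have "w \<noteq> 0" "z \<noteq> 0" using zw by auto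
  then have c_nz: "c \<noteq> 0" using b by (simp add: c_def)
  have q1: "cmod q < 1" "cmod (h * p) < 1"
  proof -
    have "cmod b ^ 2 < 1" "cmod p ^ 2 < 1"
      using b p by (simp_all add: power_less_one_iff abs_square_less_1)
    moreover from this have "cmod b ^ 2 * cmod p < 1 * 1"
      using p by (intro mult_strict_mono') auto
    ultimately show "cmod q < 1" "cmod (h * p) < 1"
      by (simp_all add: q_def h_def norm_mult norm_power)
  qed
  note nz = one_minus_mult_power_neq_0[OF q1(1) q1(1)] one_minus_mult_power_neq_0[OF q1(2) q1(1)]
  have u_Suc: "u (Suc j) = u j * ((1 - a * q ^ j) * (1 - a * p * q ^ j) * w / ((1 - q * q ^ j) * (1 - h * p * q ^ j)))" for j
    by (simp add: u_def a_def mult_ac)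
  have v_Suc: "v (Suc k) = v k * ((1 + c * q ^ k) * (1 + c * p * q ^ k) * z / ((1 - q * q ^ k) * (1 - h * p * q ^ k)))" for k
    by (simp add: v_def c_def mult_ac)
  define cp c0 cm where "cp = (1-q^2*M)*(1-h^2*q*M)*(1-h*p*q*M)*(1-h*p*M)"
    and "c0 = (z + w) * ((1-h^2*q^2*M^2)*(1+h*p*q*M)*(1-h*p*M))"
    and "cm = (1+h*M)*(1+h*p*M)*(1+h*q*M)*(1+h*p*q*M)"
  \<comment> \<open>The certificate is a multiple of the term of index \<open>j\<close> at level \<open>N + 1\<close>; its factor \<open>1 - q ^ j\<close> makes it vanish at \<open>j = 0\<close>.\<close>
  define G where "G = (\<lambda>j. (1 - q ^ j) * (p - h * q ^ j) * z * cert a c p (q * M) (q ^ (N + 1 - j)) * u j * v (N + 1 - j)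
      / ((1 - q * q ^ (N + 1 - j)) * (1 - h * p * q ^ (N + 1 - j))))"
  have step: "p * (cp * (u j * v (N + 2 - j)) - c0 * (u j * v (N + 1 - j)) + cm * (u j * v (N - j))) = G (Suc j) - G j"
    if "j \<le> N" for j
  proof -
    define k X Y where "k = N - j" and "X = q ^ j" and "Y = q ^ k"
    have M: "M = X * Y" using that by (simp add: M_def X_def Y_def k_def flip: power_add)
    have ix: "N + 2 - j = Suc (Suc k)" "N + 1 - j = Suc k" "N + 1 - Suc j = k" "N - j = k"
      using that by (auto simp: k_def)
    define e1 e2 f where "e1 = (1 - q * Y) * (1 - h * p * Y)" and "e2 = (1 - q\<^sup>2 * Y) * (1 - h * p * q * Y)"
      and "f = (1 - q * X) * (1 - h * p * X)"
    have e: "e1 \<noteq> 0" "e2 \<noteq> 0" "f \<noteq> 0"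
      using nz[of k] nz[of "Suc k"] nz[of j] by (simp_all add: e1_def e2_def f_def X_def Y_def power2_eq_square mult.assoc)
    define V where "V = u j * v k / (e1 * e2)"
    define E E' where "E = (1 + c * Y) * (1 + c * p * Y)" and "E' = (1 + c * q * Y) * (1 + c * p * q * Y)"
    have v1: "v (Suc k) = v k * (E * z / e1)"
      unfolding v_Suc E_def e1_def Y_def ..
    have v2: "v (Suc (Suc k)) = v k * (E * z / e1) * (E' * z / e2)"
      unfolding v_Suc[of "Suc k"] v1 unfolding E'_def e2_def Y_def
      by (simp add: power2_eq_square mult.assoc)
    have uv: "u j * v k = V * (e1 * e2)" "u j * v (Suc k) = V * (E * z * e2)" "u j * v (Suc (Suc k)) = V * (E * E' * z\<^sup>2)"
      using e unfolding v1 v2 V_def by (simp_all add: power2_eq_square)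
    have G1: "G (Suc j) = V * (p * (1 - a * X) * (1 - a * p * X) * e2 * cert a c p (q * M) Y)"
    proof -
      have "p - h * q ^ Suc j = p * (1 - h * p * X)"
        by (simp add: X_def q_def power2_eq_square algebra_simps)
      then have "G (Suc j) = f * p * z * cert a c p (q * M) Y * (u j * ((1 - a * X) * (1 - a * p * X) * w / f)) * v k / e1"
        unfolding G_def ix u_Suc by (simp add: f_def e1_def X_def Y_def)
      also have "\<dots> = (z * w) * V * (p * (1 - a * X) * (1 - a * p * X) * e2 * cert a c p (q * M) Y)"
        using e unfolding V_def by (simp add: field_simps)
      finally show ?thesis using zw by simp
    qed
    have G0: "G j = V * ((1 - X) * (p - h * X) * z\<^sup>2 * E * cert a c p (q * M) (q * Y))"
    proof -
      have "G j = (1 - X) * (p - h * X) * z * cert a c p (q * M) (q * Y) * u j * (v k * (E * z / e1)) / e2"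
        unfolding G_def ix v1 by (simp add: e2_def X_def Y_def power2_eq_square mult.assoc)
      then show ?thesis
        unfolding V_def by (simp add: power2_eq_square)
    qed
    have "p * (cp * (u j * v (Suc (Suc k))) - c0 * (u j * v (Suc k)) + cm * (u j * v k)) - (G (Suc j) - G j)
      = V * (p * (cp * (E * E' * z\<^sup>2) - c0 * (E * z * e2) + cm * (e1 * e2))
          - (p * (1 - a * X) * (1 - a * p * X) * e2 * cert a c p (q * M) Y
            - (1 - X) * (p - h * X) * z\<^sup>2 * E * cert a c p (q * M) (q * Y)))" (is "_ = V * ?P")
      unfolding uv G1 G0 by algebra
    \<comment> \<open>Multiplying by \<open>c\<close> eliminates \<open>z\<close>, as \<open>c * z\<^sup>2 = a\<close>.\<close>
    moreover have "c * ?P = 0"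
    proof -
      define T1 T2 c0' where "T1 = cert a c p (q * M) Y" and "T2 = cert a c p (q * M) (q * Y)"
        and "c0' = (1-h^2*q^2*M^2)*(1+h*p*q*M)*(1-h*p*M)"
      have "c * ?P = p * ((c * z\<^sup>2) * cp * (E * E') - (c * (z + w) * z) * c0' * (E * e2) + c * cm * (e1 * e2))
        - (p * c * (1 - a * X) * (1 - a * p * X) * e2 * T1 - (c * z\<^sup>2) * (1 - X) * (p - h * X) * E * T2)"
        unfolding T1_def[symmetric] T2_def[symmetric] c0_def c0'_def[symmetric] by algebra
      also have "\<dots> = 0"
        unfolding cz czw
        using step_identity[OF h meta_eq_to_obj_eq[OF q_def] M]
        unfolding T1_def T2_def cp_def cm_def E_def E'_def e1_def e2_def c0'_def
        by (simp only: mult.assoc right_minus_eq)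
      finally show ?thesis .
    qed
    ultimately show ?thesis unfolding ix using c_nz by simp
  qed
  have "p * (cp * (\<Sum>j\<le>N. u j * v (N + 2 - j)) - c0 * (\<Sum>j\<le>N. u j * v (N + 1 - j)) + cm * S N) = (\<Sum>j\<le>N. G (Suc j) - G j)"
    unfolding S_def sum_distrib_left sum_subtractf[symmetric] sum.distrib[symmetric]
    using step by (intro sum.cong) auto
  also have "\<dots> = G (Suc N) - G 0"
    using sum_lessThan_telescope[of G "Suc N"] by (simp only: lessThan_Suc_atMost)
  also have "G 0 = 0" by (simp add: G_def)
  finally have inner: "p * (cp * (\<Sum>j\<le>N. u j * v (N + 2 - j)) - c0 * (\<Sum>j\<le>N. u j * v (N + 1 - j)) + cm * S N) = G (Suc N)"
    by simp
  define X where "X = q ^ Suc N"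
  have bd: "p * (cp * (u (N + 1) * v 1 + u (N + 2)) - c0 * u (N + 1)) + G (Suc N) = 0"
  proof -
    define e f A E where "e = (1 - q) * (1 - h * p)" and "f = (1 - q * X) * (1 - h * p * X)"
      and "A = (1 - a * X) * (1 - a * p * X)" and "E = (1 + c) * (1 + c * p)"
    have nz': "e \<noteq> 0" "f \<noteq> 0"
      using nz[of 0] nz[of "Suc N"] by (simp_all add: e_def f_def X_def)
    have X: "X = q * M" "q * X = q\<^sup>2 * M"
      by (simp_all add: X_def M_def power2_eq_square)
    have qX: "q * q ^ N = X" by (simp add: X_def)
    \<comment> \<open>The common factor is \<open>U * p * K\<close>; what remains is the boundary identity divided by \<open>c * z\<close>.\<close>
    define U K T where "U = u (N + 1) / e" and "K = 1 - h * p * M" and "T = cert a c p X 1"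
    have pK: "p - h * X = p * K"
      by (simp add: K_def X q_def power2_eq_square algebra_simps)
    have u1: "u (N + 1) = U * e" and v1: "v 1 = E * z / e"
      using nz' v_Suc[of 0] by (simp_all add: U_def E_def e_def v_def)
    have u2: "u (N + 2) = U * e * (A * w / f)"
      using u_Suc[of "N + 1"] u1 by (simp add: A_def f_def X_def)
    have cp: "cp = f * (1 - h\<^sup>2 * X) * K"
      by (simp add: cp_def f_def K_def X power2_eq_square mult_ac)
    have c0: "c0 = (z + w) * ((1 - h\<^sup>2 * X\<^sup>2) * (1 + h * p * X) * K)"
      by (simp add: c0_def K_def X power_mult_distrib mult.assoc)
    have "G (Suc N) = (1 - X) * (p - h * X) * z * T * u (N + 1) / e"
      using qX by (simp add: G_def T_def X(1)[symmetric] e_def v_def)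
    then have G: "G (Suc N) = U * p * K * ((1 - X) * z * T)"
      unfolding pK using nz' by (simp add: U_def)
    have "p * (cp * (u (N + 1) * v 1 + u (N + 2)) - c0 * u (N + 1)) + G (Suc N)
      = U * p * K * ((1 - h\<^sup>2 * X) * (E * z * f + A * w * e)
          - (z + w) * ((1 - h\<^sup>2 * X\<^sup>2) * (1 + h * p * X)) * e + (1 - X) * z * T)" (is "_ = _ * ?P")
      unfolding u1 u2 v1 cp c0 G using nz' by (simp add: field_simps)
    moreover have "c * z * ?P = 0"
    proof -
      have "c * z * ?P = (1 - h\<^sup>2 * X) * ((c * z\<^sup>2) * E * f + c * (z * w) * A * e)
          - (c * (z + w) * z) * ((1 - h\<^sup>2 * X\<^sup>2) * (1 + h * p * X)) * e + (c * z\<^sup>2) * (1 - X) * T"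
        by algebra
      also have "\<dots> = 0"
        unfolding cz czw zw using boundary_identity[OF h meta_eq_to_obj_eq[OF q_def], of X]
        unfolding T_def E_def e_def f_def A_def by (simp add: mult_ac)
      finally show ?thesis .
    qed
    ultimately show ?thesis using c_nz \<open>z \<noteq> 0\<close> by simp
  qed
  have S2: "S (N + 2) = (\<Sum>j\<le>N. u j * v (N + 2 - j)) + u (N + 1) * v 1 + u (N + 2)"
    and S1: "S (N + 1) = (\<Sum>j\<le>N. u j * v (N + 1 - j)) + u (N + 1)"
    by (simp_all add: S_def v_def atMost_Suc)
  have "p * (cp * S (N + 2) - c0 * S (N + 1) + cm * S N) =
      p * (cp * (\<Sum>j\<le>N. u j * v (N + 2 - j)) - c0 * (\<Sum>j\<le>N. u j * v (N + 1 - j)) + cm * S N)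
      + p * (cp * (u (N + 1) * v 1 + u (N + 2)) - c0 * u (N + 1))"
    unfolding S1 S2 by algebra
  also have "\<dots> = 0"
    unfolding inner using bd by (simp only: add.commute)
  finally show ?thesis
    using p unfolding cp_def c0_def cm_def by simp
qed

definition gf_coeff :: "complex \<Rightarrow> complex \<Rightarrow> nat \<Rightarrow> complex" where
  "gf_coeff \<beta> p n = (let q = p\<^sup>2 in
     qpoch (- \<beta>) q n * qpoch (- \<beta> * p) q n / (qpoch (\<beta>\<^sup>2) q n * qpoch (\<beta> * p) q n))"

text \<open>
  The ratio of consecutive values of \<open>gf_coeff\<close> is exactly what turns the recurrence of the Rogers polynomials
  into the one just proved. Both sides therefore agree once they agree for \<open>n = 0\<close> and \<open>n = 1\<close>.
\<close>

lemma product_coeff_eq: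
  fixes p b z w :: complex and n :: nat
  assumes zw: "z * w = 1" and b: "cmod b < 1" "b \<noteq> 0" and p: "cmod p < 1" "p \<noteq> 0"
  defines "q \<equiv> p\<^sup>2" and "h \<equiv> b\<^sup>2"
  defines "u \<equiv> \<lambda>j. qpoch (b * z) q j * qpoch (b * z * p) q j / (qpoch q q j * qpoch (h * p) q j) * w ^ j"
    and "v \<equiv> \<lambda>k. qpoch (- (b * w)) q k * qpoch (- (b * w * p)) q k / (qpoch q q k * qpoch (h * p) q k) * z ^ k"
  shows "(\<Sum>j\<le>n. u j * v (n - j)) = gf_coeff h p n * rogers_sum h q z w n"
proof -
  define S where "S = (\<lambda>n. \<Sum>j\<le>n. u j * v (n - j))"
  define r C where "r = gf_coeff h p" and "C = rogers_sum h q z w"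
  have q1: "cmod q < 1" and h1: "cmod h < 1"
    using b p by (simp_all add: q_def h_def norm_power power_less_one_iff abs_square_less_1)
  have h2: "cmod (h\<^sup>2) < 1" and hp: "cmod (h * p) < 1"
    using h1 p mult_strict_mono'[of "cmod h" 1 "cmod p" 1]
    by (simp_all add: norm_power norm_mult abs_square_less_1)
  note nz = one_minus_mult_power_neq_0[OF q1 q1] one_minus_mult_power_neq_0[OF hp q1]
    one_minus_mult_power_neq_0[OF h2 q1] one_minus_mult_power_neq_0[OF h1 q1]
  have r_Suc: "r (Suc n) = r n * ((1 + h * q ^ n) * (1 + h * p * q ^ n)
      / ((1 - h\<^sup>2 * q ^ n) * (1 - h * p * q ^ n)))" for n
    by (simp add: r_def gf_coeff_def q_def[symmetric] times_divide_times_eq mult_ac)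
  have "S n = r n * C n"
  proof (induction n rule: induct_nat_012)
    case 0
    show ?case by (simp add: S_def u_def v_def r_def gf_coeff_def C_def)
  next
    case 1
    define e where "e = (1 - q) * (1 - h * p)"
    have e: "1 - q \<noteq> 0" "1 - h * p \<noteq> 0" "e \<noteq> 0" "1 - h\<^sup>2 \<noteq> 0"
      using nz(1)[of 0] nz(2)[of 0] nz(3)[of 0] by (simp_all add: e_def)
    have r1: "r (Suc 0) = (1 + h) * (1 + h * p) / ((1 - h\<^sup>2) * (1 - h * p))"
      using r_Suc[of 0] by (simp add: r_def gf_coeff_def)
    have "S (Suc 0) = u 0 * v (Suc 0) + u (Suc 0) * v 0"
      by (simp add: S_def)
    also have "\<dots> = ((1 + b * w) * (1 + b * w * p) * z + (1 - b * z) * (1 - b * z * p) * w) / e"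
      by (simp add: u_def v_def e_def add_divide_distrib)
    also have "(1 + b * w) * (1 + b * w * p) * z + (1 - b * z) * (1 - b * z * p) * w = (z + w) * (1 + h * p)"
      using zw unfolding h_def by algebra
    also have "(z + w) * (1 + h * p) / e = r (Suc 0) * C (Suc 0)"
    proof -
      have sq: "1 - h\<^sup>2 = (1 + h) * (1 - h)" by algebra
      with e(4) have h: "1 + h \<noteq> 0" "1 - h \<noteq> 0" by auto
      then have "r (Suc 0) = (1 + h * p) / ((1 - h) * (1 - h * p))"
        unfolding r1 sq by (simp del: right_minus_eq)
      then show ?thesis
        using h(2) unfolding C_def rogers_sum_1 e_def by (simp add: mult.commute)
    qed
    finally show ?case .
  next
    case (ge2 n)
    define M where "M = q ^ n"
    \<comment> \<open>With this factor \<open>K\<close> the coefficients of the recurrence for \<open>r n * C n\<close> are those of the recurrence for \<open>C n\<close>.\<close>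
    define K where "K = r (n + 1) * ((1 - h * p * M) * (1 + h * q * M) * (1 + h * p * q * M))"
    have nzM: "1 - h\<^sup>2 * q * M \<noteq> 0" "1 - h * p * q * M \<noteq> 0" "1 - h * p * M \<noteq> 0" "1 - h\<^sup>2 * M \<noteq> 0" "1 - q\<^sup>2 * M \<noteq> 0"
      using nz(3)[of "Suc n"] nz(2)[of "Suc n"] nz(2)[of n] nz(3)[of n] nz(1)[of "Suc n"]
      by (simp_all add: M_def mult.assoc power2_eq_square)
    let ?cp = "(1-q^2*M)*(1-h^2*q*M)*(1-h*p*q*M)*(1-h*p*M)"
      and ?c0 = "(1-h^2*q^2*M^2)*(1+h*p*q*M)*(1-h*p*M)"
      and ?cm = "(1+h*M)*(1+h*p*M)*(1+h*q*M)*(1+h*p*q*M)"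
    have rp: "?cp * r (n + 2) = K * (1 - q\<^sup>2 * M)"
    proof -
      have "r (n + 2) = r (n + 1) * ((1 + h * q * M) * (1 + h * p * q * M) / ((1 - h\<^sup>2 * q * M) * (1 - h * p * q * M)))"
        using r_Suc[of "n + 1"] by (simp add: M_def mult.assoc)
      then show ?thesis using nzM unfolding K_def by simp
    qed
    have r0: "?c0 * r (n + 1) = K * (1 - h * q * M)"
      unfolding K_def by algebra
    have rm: "?cm * r n = K * (1 - h\<^sup>2 * M)"
    proof -
      have "r (n + 1) = r n * ((1 + h * M) * (1 + h * p * M) / ((1 - h\<^sup>2 * M) * (1 - h * p * M)))"
        using r_Suc[of n] by (simp add: M_def)
      then show ?thesis using nzM unfolding K_def by simp
    qed
    have pw: "q ^ (n + 2) = q\<^sup>2 * M" "q ^ (n + 1) = q * M" "q ^ n = M"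
      by (simp_all add: M_def power2_eq_square)
    have rec: "?cp * S (n + 2) - (z + w) * ?c0 * S (n + 1) + ?cm * S n = 0"
      using generating_coeff_recurrence[OF zw b p, of n]
      unfolding q_def[symmetric] h_def[symmetric] unfolding S_def u_def v_def M_def .
    have "x = y - y'" if "x - y + y' = 0" for x y y' :: complex
      using that by algebra
    from this[OF rec] have "?cp * S (n + 2) = (z + w) * ?c0 * S (n + 1) - ?cm * S n" .
    also have "\<dots> = (z + w) * (?c0 * r (n + 1)) * C (n + 1) - (?cm * r n) * C n"
      using ge2 by (simp only: Suc_eq_plus1 mult.assoc)
    also have "\<dots> = K * ((z + w) * (1 - h * (q * M)) * C (n + 1) - (1 - h\<^sup>2 * M) * C n)"
      unfolding r0 rm by algebra
    also have "\<dots> = K * ((1 - q\<^sup>2 * M) * C (n + 2))"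
      using rogers_sum_recurrence[OF zw q1, of n h] unfolding C_def pw by (simp only: )
    also have "\<dots> = ?cp * (r (n + 2) * C (n + 2))"
      using rp by (simp only: mult.assoc[symmetric])
    finally have "?cp * S (n + 2) = ?cp * (r (n + 2) * C (n + 2))" .
    moreover have "?cp \<noteq> 0" using nzM by (simp del: right_minus_eq)
    ultimately have "S (n + 2) = r (n + 2) * C (n + 2)"
      by (rule mult_left_cancel[THEN iffD1, rotated])
    then show ?case by (simp only: Suc_eq_plus1 add.assoc one_add_one)
  qed
  then show ?thesis by (simp add: S_def r_def C_def)
qed

section \<open>The product as a generating function\<close>

text \<open>
  The coefficients of the two series are bounded on the circle \<open>cmod z = 1\<close>, hence for \<open>cmod t < 1\<close> both converge
  absolutely and have a Cauchy product.
\<close>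

lemma product_generating_function:
  fixes p b z w t :: complex
  assumes zw: "z * w = 1" and z1: "cmod z = 1" and b: "cmod b < 1" "b \<noteq> 0" and p: "cmod p < 1" "p \<noteq> 0"
    and t: "cmod t < 1"
  defines "q \<equiv> p\<^sup>2" and "h \<equiv> b\<^sup>2"
  shows "(\<lambda>n. gf_coeff h p n * rogers_sum h q z w n * t ^ n) sums
    (qphi [b * z, p * b * z] [h * p] q (t * w) * qphi [- b * w, - (p * b) * w] [h * p] q (t * z))"
proof -
  have w1: "cmod w = 1" using zw z1 by (metis mult_1 norm_mult norm_one)
  have q1: "cmod q < 1" and h1: "cmod h < 1"
    using b p by (simp_all add: q_def h_def norm_power power_less_one_iff abs_square_less_1)
  have hp: "cmod (h * p) < 1"
    using h1 p mult_strict_mono'[of "cmod h" 1 "cmod p" 1] by (simp add: norm_mult)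
  have summable: "summable (\<lambda>j. norm (qpoch x q j * qpoch y q j / (qpoch q q j * qpoch (h * p) q j) * s ^ j * t ^ j))"
    if s: "cmod s = 1" for x y s
  proof -
    obtain K where K: "K > 0" "\<And>n. cmod (qpoch x q n / qpoch q q n) \<le> K"
      using qpoch_quotient_bounded[OF q1 q1] by blast
    obtain L where L: "L > 0" "\<And>n. cmod (qpoch y q n / qpoch (h * p) q n) \<le> L"
      using qpoch_quotient_bounded[OF hp q1] by blast
    show ?thesis
    proof (rule summable_comparison_test')
      show "summable (\<lambda>j. K * L * cmod t ^ j)"
        using t by (intro summable_mult summable_geometric) auto
      fix j
      have "norm (norm (qpoch x q j * qpoch y q j / (qpoch q q j * qpoch (h * p) q j) * s ^ j * t ^ j))
        = cmod (qpoch x q j / qpoch q q j) * cmod (qpoch y q j / qpoch (h * p) q j) * cmod t ^ j"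
        using s by (simp add: norm_mult norm_divide norm_power)
      also have "\<dots> \<le> K * L * cmod t ^ j"
        using K L by (intro mult_mono) auto
      finally show "norm (norm (qpoch x q j * qpoch y q j / (qpoch q q j * qpoch (h * p) q j) * s ^ j * t ^ j)) \<le> K * L * cmod t ^ j" .
    qed
  qed
  define u where "u = (\<lambda>j. qpoch (b * z) q j * qpoch (b * z * p) q j / (qpoch q q j * qpoch (h * p) q j) * w ^ j)"
  define v where "v = (\<lambda>k. qpoch (- (b * w)) q k * qpoch (- (b * w * p)) q k / (qpoch q q k * qpoch (h * p) q k) * z ^ k)"
  have "(\<lambda>n. \<Sum>j\<le>n. (u j * t ^ j) * (v (n - j) * t ^ (n - j))) sums ((\<Sum>j. u j * t ^ j) * (\<Sum>k. v k * t ^ k))"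
    unfolding u_def v_def by (rule Cauchy_product_sums) (rule summable z1 w1)+
  also have "(\<lambda>n. \<Sum>j\<le>n. (u j * t ^ j) * (v (n - j) * t ^ (n - j))) = (\<lambda>n. gf_coeff h p n * rogers_sum h q z w n * t ^ n)"
  proof
    fix n
    have "(\<Sum>j\<le>n. (u j * t ^ j) * (v (n - j) * t ^ (n - j))) = (\<Sum>j\<le>n. u j * v (n - j)) * t ^ n"
      unfolding sum_distrib_right
    proof (intro sum.cong refl)
      fix j assume "j \<in> {..n}"
      then have "t ^ n = t ^ j * t ^ (n - j)" by (simp flip: power_add)
      then show "(u j * t ^ j) * (v (n - j) * t ^ (n - j)) = u j * v (n - j) * t ^ n" by simp
    qed
    also have "(\<Sum>j\<le>n. u j * v (n - j)) = gf_coeff h p n * rogers_sum h q z w n"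
      using product_coeff_eq[OF zw b p, of n] unfolding u_def v_def q_def h_def .
    finally show "(\<Sum>j\<le>n. (u j * t ^ j) * (v (n - j) * t ^ (n - j))) = gf_coeff h p n * rogers_sum h q z w n * t ^ n" .
  qed
  also have "(\<Sum>j. u j * t ^ j) = qphi [b * z, p * b * z] [h * p] q (t * w)"
    by (simp add: qphi_balanced_length u_def power_mult_distrib mult_ac)
  also have "(\<Sum>k. v k * t ^ k) = qphi [- b * w, - (p * b) * w] [h * p] q (t * z)"
    by (simp add: qphi_balanced_length v_def power_mult_distrib mult_ac)
  finally show ?thesis .
qed

section \<open>Bounds and the rearrangement of the double series\<close>

lemma gf_coeff_bounded:
  assumes "cmod \<beta> < 1" "cmod p < 1"
  obtains K where "K > 0" "\<And>n. cmod (gf_coeff \<beta> p n) \<le> K"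
proof -
  have q1: "cmod (p\<^sup>2) < 1" and b2: "cmod (\<beta>\<^sup>2) < 1" and bp: "cmod (\<beta> * p) < 1"
    using assms mult_strict_mono'[of "cmod \<beta>" 1 "cmod p" 1]
    by (simp_all add: norm_power norm_mult abs_square_less_1)
  obtain K where K: "K > 0" "\<And>n. cmod (qpoch (- \<beta>) (p\<^sup>2) n / qpoch (\<beta>\<^sup>2) (p\<^sup>2) n) \<le> K"
    using qpoch_quotient_bounded[OF b2 q1] by blast
  obtain L where L: "L > 0" "\<And>n. cmod (qpoch (- \<beta> * p) (p\<^sup>2) n / qpoch (\<beta> * p) (p\<^sup>2) n) \<le> L"
    using qpoch_quotient_bounded[OF bp q1] by blast
  have "cmod (gf_coeff \<beta> p n) \<le> K * L" for n
  proof -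
    have "gf_coeff \<beta> p n = qpoch (- \<beta>) (p\<^sup>2) n / qpoch (\<beta>\<^sup>2) (p\<^sup>2) n * (qpoch (- \<beta> * p) (p\<^sup>2) n / qpoch (\<beta> * p) (p\<^sup>2) n)"
      by (simp add: gf_coeff_def Let_def)
    then have "cmod (gf_coeff \<beta> p n) = cmod (qpoch (- \<beta>) (p\<^sup>2) n / qpoch (\<beta>\<^sup>2) (p\<^sup>2) n)
        * cmod (qpoch (- \<beta> * p) (p\<^sup>2) n / qpoch (\<beta> * p) (p\<^sup>2) n)"
      by (simp only: norm_mult)
    also have "\<dots> \<le> K * L"
      using K L by (intro mult_mono) (auto intro: less_imp_le)
    finally show ?thesis .
  qed
  then show ?thesis using K L that[of "K * L"] by simp
qed

lemma connection_coeff_bounded: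
  assumes \<gamma>: "cmod \<gamma> < 1" and q: "cmod q < 1"
  obtains K where "K > 0" "\<And>m k. cmod (connection_coeff \<beta> \<gamma> q m k) \<le> K * cmod \<gamma> ^ k"
proof -
  have \<gamma>q: "cmod (\<gamma> * q) < 1"
    using \<gamma> q mult_strict_mono'[of "cmod \<gamma>" 1 "cmod q" 1] by (simp add: norm_mult)
  obtain K where K: "K > 0" "\<And>n. cmod (qpoch (\<beta> / \<gamma>) q n / qpoch q q n) \<le> K"
    using qpoch_quotient_bounded[OF q q] by blast
  obtain L where L: "L > 0" "\<And>n. cmod (qpoch \<beta> q n / qpoch (\<gamma> * q) q n) \<le> L"
    using qpoch_quotient_bounded[OF \<gamma>q q] by blast
  define D where "D = cmod (1 - \<gamma>)"
  have D: "D > 0" using \<gamma> by (auto simp: D_def)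
  have "cmod (connection_coeff \<beta> \<gamma> q m k) \<le> K * L * (2 / D) * cmod \<gamma> ^ k" for m k
  proof -
    have "cmod (\<gamma> * q ^ m) \<le> 1 * 1"
      unfolding norm_mult norm_power using \<gamma> q by (intro mult_mono power_le_one) auto
    then have "cmod (1 - \<gamma> * q ^ m) \<le> 2"
      using norm_triangle_ineq4[of 1 "\<gamma> * q ^ m"] by simp
    then have "cmod ((1 - \<gamma> * q ^ m) / (1 - \<gamma>)) \<le> 2 / D"
      using D by (simp add: norm_divide D_def divide_right_mono)
    note bound = this
    have "connection_coeff \<beta> \<gamma> q m k = qpoch (\<beta> / \<gamma>) q k / qpoch q q k
        * (qpoch \<beta> q (m + k) / qpoch (\<gamma> * q) q (m + k)) * ((1 - \<gamma> * q ^ m) / (1 - \<gamma>)) * \<gamma> ^ k"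
      by (simp add: connection_coeff_def)
    then have "cmod (connection_coeff \<beta> \<gamma> q m k) = cmod (qpoch (\<beta> / \<gamma>) q k / qpoch q q k)
        * cmod (qpoch \<beta> q (m + k) / qpoch (\<gamma> * q) q (m + k)) * cmod ((1 - \<gamma> * q ^ m) / (1 - \<gamma>)) * cmod \<gamma> ^ k"
      by (simp only: norm_mult norm_power)
    also have "\<dots> \<le> K * L * (2 / D) * cmod \<gamma> ^ k"
      using K L D bound by (intro mult_mono mult_nonneg_nonneg) (auto intro: less_imp_le)
    finally show ?thesis .
  qed
  then show ?thesis using K L D that[of "K * L * (2 / D)"] by simp
qed

lemma rogers_sum_bounded:
  assumes z: "cmod z = 1" and w: "cmod w = 1" and q: "cmod q < 1"
  obtains K where "K > 0" "\<And>n. cmod (rogers_sum \<beta> q z w n) \<le> K * real (Suc n)"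
proof -
  obtain K where K: "K > 0" "\<And>n. cmod (qpoch \<beta> q n / qpoch q q n) \<le> K"
    using qpoch_quotient_bounded[OF q q] by blast
  have "cmod (rogers_sum \<beta> q z w n) \<le> K\<^sup>2 * real (Suc n)" for n
  proof -
    have "cmod (rogers_sum \<beta> q z w n) \<le> (\<Sum>k\<le>n. K\<^sup>2)"
      unfolding rogers_sum_def
    proof (rule sum_norm_le)
      fix k
      have "cmod (qpoch \<beta> q k / qpoch q q k * z ^ k * (qpoch \<beta> q (n - k) / qpoch q q (n - k) * w ^ (n - k)))
        = cmod (qpoch \<beta> q k / qpoch q q k) * cmod (qpoch \<beta> q (n - k) / qpoch q q (n - k))"
        using z w by (simp add: norm_mult norm_power norm_divide)
      also have "\<dots> \<le> K * K" using K by (intro mult_mono) auto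
      finally show "cmod (qpoch \<beta> q k / qpoch q q k * z ^ k * (qpoch \<beta> q (n - k) / qpoch q q (n - k) * w ^ (n - k))) \<le> K\<^sup>2"
        by (simp add: power2_eq_square)
    qed
    then show ?thesis by (simp add: mult.commute)
  qed
  then show ?thesis using K that[of "K\<^sup>2"] by simp
qed

text \<open>
  Both orders of summation compute the sum of the same summable family: over the antidiagonals, and over
  the rows \<open>{m} \<times> UNIV\<close>.
\<close>

lemma sums_rearrange_step_pairs:
  fixes f :: "nat \<Rightarrow> nat \<Rightarrow> complex"
  assumes f: "(\<lambda>(m, k). f m k) summable_on UNIV" and s: "(\<lambda>n. \<Sum>(m, k)\<in>step_pairs n. f m k) sums s"
  shows "(\<lambda>m. \<Sum>k. f m k) sums s"
proof -
  define F where "F = (\<lambda>(m, k). f m k)"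
  obtain S where S: "(F has_sum S) UNIV" using f by (auto simp: F_def summable_on_def)
  have "((\<lambda>(n, x). F x) has_sum S) (Sigma UNIV step_pairs)"
  proof (subst has_sum_reindex_bij_witness[of _ "\<lambda>(m, k). (m + 2 * k, (m, k))" snd UNIV F _ S S])
    show "(F has_sum S) UNIV" by fact
  qed (auto simp: step_pairs_def)
  then have "((\<lambda>n. \<Sum>x\<in>step_pairs n. F x) has_sum S) UNIV"
    by (rule has_sum_SigmaD) (simp add: has_sum_finite)
  then have "(\<lambda>n. \<Sum>x\<in>step_pairs n. F x) sums S"
    by (rule has_sum_imp_sums)
  then have [simp]: "S = s" using s unfolding F_def by (rule sums_unique2)
  have "((\<lambda>m. \<Sum>k. f m k) has_sum s) UNIV"
  proof (rule has_sum_SigmaD)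
    show "(F has_sum s) (UNIV \<times> UNIV)" using S by simp
    fix m
    have "(\<lambda>k. f m k) summable_on UNIV"
      using f unfolding UNIV_Times_UNIV[symmetric] by (rule summable_on_SigmaD1) simp
    then have "((\<lambda>k. f m k) has_sum (\<Sum>\<^sub>\<infinity>k. f m k)) UNIV" by (rule has_sum_infsum)
    moreover from has_sum_imp_sums[OF this] have "(\<Sum>\<^sub>\<infinity>k. f m k) = (\<Sum>k. f m k)" by (rule sums_unique)
    ultimately show "((\<lambda>k. F (m, k)) has_sum (\<Sum>k. f m k)) UNIV" by (simp add: F_def)
  qed
  then show ?thesis by (rule has_sum_imp_sums)
qed

lemma summable_on_product_bound:
  fixes f :: "nat \<Rightarrow> nat \<Rightarrow> complex"
  assumes x: "0 \<le> x" "x < 1" and y: "0 \<le> y" "y < 1"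
    and f: "\<And>m k. cmod (f m k) \<le> K * (real (Suc m) * x ^ m) * y ^ k"
  shows "(\<lambda>(m, k). f m k) summable_on UNIV"
proof -
  have X: "(\<lambda>m. real (Suc m) * x ^ m) summable_on UNIV"
    using geometric_deriv_sums[of x] x by (subst summable_on_UNIV_nonneg_real_iff) (auto simp: sums_iff)
  have Y: "((\<lambda>k. y ^ k) has_sum (\<Sum>k. y ^ k)) UNIV"
    using y by (intro norm_summable_imp_has_sum) (auto intro!: summable_sums summable_geometric)
  have "(\<lambda>(m, k). (real (Suc m) * x ^ m) * y ^ k) summable_on (UNIV \<times> UNIV)"
  proof (rule summable_on_SigmaI)
    fix m :: nat
    show "((\<lambda>k. case (m, k) of (m, k) \<Rightarrow> (real (Suc m) * x ^ m) * y ^ k) has_sum ((real (Suc m) * x ^ m) * (\<Sum>k. y ^ k))) UNIV"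
      using has_sum_cmult_right[OF Y, of "real (Suc m) * x ^ m"] by simp
  qed (use X x y in \<open>auto intro: summable_on_cmult_left\<close>)
  then have "(\<lambda>z. K * (case z of (m, k) \<Rightarrow> (real (Suc m) * x ^ m) * y ^ k)) summable_on UNIV"
    by (intro summable_on_cmult_right) simp
  then have "(\<lambda>z. norm (case z of (m, k) \<Rightarrow> f m k)) summable_on UNIV"
    by (rule Infinite_Sum.abs_summable_on_comparison_test') (use f in \<open>auto simp: mult.assoc\<close>)
  then show ?thesis by (rule Infinite_Sum.abs_summable_summable)
qed

section \<open>The expansion with a free parameter\<close>

text \<open>
  The parameters of the \<open>10\<phi>9\<close> series, with \<open>s\<close> for the fourth root of \<open>q\<close>; abbreviations so that the
  lists appear literally in the statements below.
\<close>

abbreviation (input) phi_upper :: "complex \<Rightarrow> complex \<Rightarrow> complex \<Rightarrow> complex \<Rightarrow> complex \<Rightarrow> nat \<Rightarrow> complex list" where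
  "phi_upper \<beta> \<gamma> b p s n \<equiv> [\<beta> / \<gamma>, \<beta> * (p\<^sup>2) ^ n]
     @ pm (\<i> * (b * p ^ n)) @ pm (\<i> * (b * p ^ (n + 1)))
     @ pm (\<i> * (b * p ^ n * s)) @ pm (\<i> * (b * p ^ (n + 1) * s))"

abbreviation (input) phi_lower :: "complex \<Rightarrow> complex \<Rightarrow> complex \<Rightarrow> complex \<Rightarrow> complex \<Rightarrow> nat \<Rightarrow> complex list" where
  "phi_lower \<beta> \<gamma> b p s n \<equiv> [\<gamma> * (p\<^sup>2) ^ (n + 1)]
     @ pm (\<beta> * p ^ n) @ pm (\<beta> * p ^ (n + 1))
     @ pm (b * p ^ n * s) @ pm (b * p ^ (n + 1) * s)"

text \<open>
  The terms of the \<open>10\<phi>9\<close> series match those of a row of the double series. Each factorial of length \<open>n + 2 k\<close>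
  splits by \<open>qpochs_pm_pm\<close>, and those of length \<open>n + k\<close> split into lengths \<open>n\<close> and \<open>k\<close>. The factor
  \<open>1 - \<gamma> q\<^sup>n\<close> of the connection coefficient is absorbed by \<open>(\<gamma>; q)\<^sub>n (1 - \<gamma> q\<^sup>n) = (1 - \<gamma>) (\<gamma> q; q)\<^sub>n\<close>.
\<close>

lemma phi_term:
  fixes b p s \<gamma> t :: complex and n k :: nat
  assumes \<gamma>: "cmod \<gamma> < 1" and b: "cmod b < 1" and p: "cmod p < 1" and s: "s\<^sup>2 = p"
  defines "q \<equiv> p\<^sup>2" and "\<beta> \<equiv> b\<^sup>2"
  shows "qpochs (pm \<beta> @ [- \<beta> * p]) q n / qpochs [\<gamma>, \<beta>\<^sup>2, \<beta> * p] q n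
       * (qpochs (phi_upper \<beta> \<gamma> b p s n) q k / qpochs (q # phi_lower \<beta> \<gamma> b p s n) q k * (\<gamma> * t\<^sup>2) ^ k)
     = gf_coeff \<beta> p (n + 2 * k) * connection_coeff \<beta> \<gamma> q n k * t ^ (2 * k)"
proof -
  have q1: "cmod q < 1" and \<beta>1: "cmod \<beta> < 1"
    using b p by (simp_all add: q_def \<beta>_def norm_power power_less_one_iff abs_square_less_1)
  have less: "cmod (x * y) < 1" if "cmod x < 1" "cmod y < 1" for x y
    using that mult_strict_mono'[of "cmod x" 1 "cmod y" 1] by (simp add: norm_mult)
  have small: "cmod (- \<beta>) < 1" "cmod (- \<beta> * p) < 1" "cmod (\<beta>\<^sup>2) < 1" "cmod (\<beta> * p) < 1" "cmod (\<gamma> * q) < 1"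
    using less[OF \<beta>1 p] less[OF \<beta>1 \<beta>1] less[OF \<gamma> q1] \<beta>1 by (simp_all add: power2_eq_square)
  note nz = small(1-5)[THEN qpoch_neq_0[OF _ q1]] qpoch_neq_0[OF \<beta>1 q1] qpoch_neq_0[OF \<gamma> q1]
  have pn: "(p ^ n)\<^sup>2 = q ^ n"
    by (simp add: q_def power_mult[symmetric] mult.commute)
  have quad: "qpochs (pm (\<i> * (b * p ^ n))) q k * qpochs (pm (\<i> * (b * p ^ (n + 1)))) q k
      = qpoch (- \<beta>) q (n + 2 * k) / qpoch (- \<beta>) q n"
    "qpochs (pm (\<i> * (b * p ^ n * s))) q k * qpochs (pm (\<i> * (b * p ^ (n + 1) * s))) q k
      = qpoch (- \<beta> * p) q (n + 2 * k) / qpoch (- \<beta> * p) q n"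
    "qpochs (pm (\<beta> * p ^ n)) q k * qpochs (pm (\<beta> * p ^ (n + 1))) q k
      = qpoch (\<beta>\<^sup>2) q (n + 2 * k) / qpoch (\<beta>\<^sup>2) q n"
    "qpochs (pm (b * p ^ n * s)) q k * qpochs (pm (b * p ^ (n + 1) * s)) q k
      = qpoch (\<beta> * p) q (n + 2 * k) / qpoch (\<beta> * p) q n"
    by (rule qpochs_pm_pm; use nz in \<open>simp add: power_mult_distrib pn s \<beta>_def q_def\<close>)+
  have up: "qpochs (phi_upper \<beta> \<gamma> b p s n) q k = qpoch (\<beta> / \<gamma>) q k * qpoch (\<beta> * q ^ n) q k
      * (qpoch (- \<beta>) q (n + 2 * k) / qpoch (- \<beta>) q n) * (qpoch (- \<beta> * p) q (n + 2 * k) / qpoch (- \<beta> * p) q n)"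
    unfolding quad(1,2)[symmetric] by (simp add: q_def[symmetric] mult.assoc)
  have low: "qpochs (q # phi_lower \<beta> \<gamma> b p s n) q k = qpoch q q k * qpoch (\<gamma> * q * q ^ n) q k
      * (qpoch (\<beta>\<^sup>2) q (n + 2 * k) / qpoch (\<beta>\<^sup>2) q n) * (qpoch (\<beta> * p) q (n + 2 * k) / qpoch (\<beta> * p) q n)"
    unfolding quad(3,4)[symmetric] by (simp add: q_def[symmetric] mult.assoc)
  have pre: "qpochs (pm \<beta> @ [- \<beta> * p]) q n / qpochs [\<gamma>, \<beta>\<^sup>2, \<beta> * p] q n
      = qpoch \<beta> q n * qpoch (- \<beta>) q n * qpoch (- \<beta> * p) q n / (qpoch \<gamma> q n * qpoch (\<beta>\<^sup>2) q n * qpoch (\<beta> * p) q n)"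
    by (simp add: pm_def mult.assoc)
  have b1: "qpoch \<beta> q (n + k) = qpoch \<beta> q n * qpoch (\<beta> * q ^ n) q k"
    and g1: "qpoch (\<gamma> * q) q (n + k) = qpoch (\<gamma> * q) q n * qpoch (\<gamma> * q * q ^ n) q k"
    by (rule qpoch_add)+
  have g2: "qpoch \<gamma> q n * (1 - \<gamma> * q ^ n) = (1 - \<gamma>) * qpoch (\<gamma> * q) q n"
    using qpoch_add[of \<gamma> q 1 n] by simp
  have nz1: "1 - \<gamma> \<noteq> 0" using \<gamma> by auto
  have g3: "(1 - \<gamma> * q ^ n) / (qpoch (\<gamma> * q) q (n + k) * (1 - \<gamma>)) = 1 / (qpoch \<gamma> q n * qpoch (\<gamma> * q * q ^ n) q k)"
  proof -
    have "1 - \<gamma> * q ^ n = (1 - \<gamma>) * qpoch (\<gamma> * q) q n / qpoch \<gamma> q n"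
      using g2 nz by (simp add: eq_divide_eq mult.commute)
    then show ?thesis using nz nz1 unfolding g1 by (simp del: right_minus_eq)
  qed
  have "connection_coeff \<beta> \<gamma> q n k = \<gamma> ^ k * qpoch (\<beta> / \<gamma>) q k * qpoch \<beta> q (n + k) / qpoch q q k
      * ((1 - \<gamma> * q ^ n) / (qpoch (\<gamma> * q) q (n + k) * (1 - \<gamma>)))"
    by (simp add: connection_coeff_def mult_ac)
  then have cc: "connection_coeff \<beta> \<gamma> q n k = \<gamma> ^ k * qpoch (\<beta> / \<gamma>) q k * qpoch \<beta> q n * qpoch (\<beta> * q ^ n) q k
      / (qpoch q q k * qpoch \<gamma> q n * qpoch (\<gamma> * q * q ^ n) q k)"
    unfolding g3 b1 by (simp add: mult.assoc)
  have gf: "gf_coeff \<beta> p (n + 2 * k) = qpoch (- \<beta>) q (n + 2 * k) * qpoch (- \<beta> * p) q (n + 2 * k)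
      / (qpoch (\<beta>\<^sup>2) q (n + 2 * k) * qpoch (\<beta> * p) q (n + 2 * k))"
    by (simp add: gf_coeff_def Let_def q_def)
  have cancel: "B * C * D / (G * E * F) * (U * V * (C' / C) * (D' / D) / (Q * W * (E' / E) * (F' / F)) * (g * \<tau>) ^ k)
      = C' * D' / (E' * F') * (g ^ k * U * B * V / (Q * G * W)) * \<tau> ^ k"
    if "C \<noteq> 0" "D \<noteq> 0" "E \<noteq> 0" "F \<noteq> 0" for B C D G E F U V C' D' Q W E' F' g \<tau> :: complex
    using that by (simp add: power_mult_distrib mult_ac)
  show ?thesis
    unfolding up low pre cc gf power_mult[of t 2 k] by (rule cancel) (rule nz)+
qed

text \<open>
  The rows of the double series are the terms of the asserted expansion, and its antidiagonals are the
  terms of the generating function, by the connection formula.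
\<close>

theorem product_rogers_expansion:
  fixes b p s \<gamma> t :: complex and \<theta> :: real
  assumes \<gamma>: "cmod \<gamma> < 1" "\<gamma> \<noteq> 0" and b: "cmod b < 1" "b \<noteq> 0"
    and p: "cmod p < 1" "p \<noteq> 0" and s: "s\<^sup>2 = p"
    and t: "cmod t < 1"
  defines "q \<equiv> p\<^sup>2" and "\<beta> \<equiv> b\<^sup>2"
  shows "(\<lambda>n. qpochs (pm \<beta> @ [- \<beta> * p]) q n * t ^ n / qpochs [\<gamma>, \<beta>\<^sup>2, \<beta> * p] q n
          * rogers_C n (cos (of_real \<theta>)) \<gamma> q
          * qphi (phi_upper \<beta> \<gamma> b p s n) (phi_lower \<beta> \<gamma> b p s n) q (\<gamma> * t\<^sup>2))
     sums
       (qphi [b * exp (\<i> * \<theta>), p * b * exp (\<i> * \<theta>)] [\<beta> * p] q (t * exp (- \<i> * \<theta>))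
        * qphi [- b * exp (- \<i> * \<theta>), - (p * b) * exp (- \<i> * \<theta>)] [\<beta> * p] q (t * exp (\<i> * \<theta>)))"
proof -
  define z w where "z = exp (\<i> * \<theta>)" and "w = exp (- \<i> * \<theta>)"
  have zw: "z * w = 1" by (simp add: z_def w_def flip: exp_add)
  have z1: "cmod z = 1" by (simp add: z_def)
  have w1: "cmod w = 1" using zw z1 by (metis mult_1 norm_mult norm_one)
  have q1: "cmod q < 1" "q \<noteq> 0" and \<beta>1: "cmod \<beta> < 1" "\<beta> \<noteq> 0"
    using b p by (simp_all add: q_def \<beta>_def norm_power power_less_one_iff abs_square_less_1)
  define C where "C = rogers_sum \<gamma> q z w"
  define e f where "e = (\<lambda>m k. gf_coeff \<beta> p (m + 2 * k) * connection_coeff \<beta> \<gamma> q m k * t ^ (2 * k))"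
    and "f = (\<lambda>m k. e m k * (C m * t ^ m))"
  obtain K1 where K1: "K1 > 0" "\<And>n. cmod (gf_coeff \<beta> p n) \<le> K1"
    using gf_coeff_bounded[OF \<beta>1(1) p(1)] by blast
  obtain K2 where K2: "K2 > 0" "\<And>m k. cmod (connection_coeff \<beta> \<gamma> q m k) \<le> K2 * cmod \<gamma> ^ k"
    using connection_coeff_bounded[OF \<gamma>(1) q1(1)] by blast
  obtain K3 where K3: "K3 > 0" "\<And>n. cmod (C n) \<le> K3 * real (Suc n)"
    using rogers_sum_bounded[OF z1 w1 q1(1)] unfolding C_def by blast
  define y where "y = cmod \<gamma> * cmod t ^ 2"
  have y: "0 \<le> y" "y < 1"
  proof -
    have "y \<le> cmod \<gamma> * 1"
      unfolding y_def using t by (intro mult_left_mono power_le_one) auto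
    then show "y < 1" using \<gamma>(1) by simp
  qed (simp add: y_def)
  have e_bound: "cmod (e m k) \<le> K1 * K2 * y ^ k" for m k
  proof -
    have "cmod (e m k) = cmod (gf_coeff \<beta> p (m + 2 * k)) * cmod (connection_coeff \<beta> \<gamma> q m k) * (cmod t ^ 2) ^ k"
      by (simp add: e_def norm_mult norm_power power_mult)
    also have "\<dots> \<le> K1 * (K2 * cmod \<gamma> ^ k) * (cmod t ^ 2) ^ k"
      using K1 K2(1) K2(2)[of m k] by (intro mult_mono mult_nonneg_nonneg) (auto intro: less_imp_le)
    finally show ?thesis by (simp add: y_def power_mult_distrib mult.assoc)
  qed
  have f_bound: "cmod (f m k) \<le> (K1 * K2 * K3) * (real (Suc m) * cmod t ^ m) * y ^ k" for m k
  proof -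
    have "cmod (f m k) = cmod (e m k) * (cmod (C m) * cmod t ^ m)"
      by (simp add: f_def norm_mult norm_power)
    also have "\<dots> \<le> (K1 * K2 * y ^ k) * ((K3 * real (Suc m)) * cmod t ^ m)"
      using e_bound[of m k] K3(1) K3(2)[of m] K1(1) K2(1) y(1)
      by (intro mult_mono mult_nonneg_nonneg) (auto intro: less_imp_le)
    finally show ?thesis by (simp only: mult_ac)
  qed
  have "(\<lambda>(m, k). f m k) summable_on UNIV"
    by (rule summable_on_product_bound[OF _ t y f_bound]) simp
  moreover have "(\<lambda>n. \<Sum>(m, k)\<in>step_pairs n. f m k)
    sums (qphi [b * z, p * b * z] [\<beta> * p] q (t * w) * qphi [- b * w, - (p * b) * w] [\<beta> * p] q (t * z))"
  proof -
    have "(\<Sum>(m, k)\<in>step_pairs n. f m k) = gf_coeff \<beta> p n * rogers_sum \<beta> q z w n * t ^ n" for n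
      unfolding rogers_sum_connection[OF zw \<gamma> q1(1), of \<beta>] sum_distrib_left sum_distrib_right
      by (intro sum.cong) (auto simp: step_pairs_def f_def e_def C_def power_add mult_ac)
    then show ?thesis
      using product_generating_function[OF zw z1 b p t] unfolding q_def \<beta>_def by simp
  qed
  ultimately have "(\<lambda>m. \<Sum>k. f m k)
    sums (qphi [b * z, p * b * z] [\<beta> * p] q (t * w) * qphi [- b * w, - (p * b) * w] [\<beta> * p] q (t * z))"
    by (rule sums_rearrange_step_pairs)
  also have "(\<lambda>m. \<Sum>k. f m k) = (\<lambda>n. qpochs (pm \<beta> @ [- \<beta> * p]) q n * t ^ n / qpochs [\<gamma>, \<beta>\<^sup>2, \<beta> * p] q n
          * rogers_C n (cos (of_real \<theta>)) \<gamma> q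
          * qphi (phi_upper \<beta> \<gamma> b p s n) (phi_lower \<beta> \<gamma> b p s n) q (\<gamma> * t\<^sup>2))"
  proof
    fix n
    define P where "P = qpochs (pm \<beta> @ [- \<beta> * p]) q n / qpochs [\<gamma>, \<beta>\<^sup>2, \<beta> * p] q n"
    define T where "T = (\<lambda>k. qpochs (phi_upper \<beta> \<gamma> b p s n) q k / qpochs (q # phi_lower \<beta> \<gamma> b p s n) q k * (\<gamma> * t\<^sup>2) ^ k)"
    have e_eq: "e n = (\<lambda>k. P * T k)"
      using phi_term[OF \<gamma>(1) b(1) p(1) s, of n] unfolding e_def P_def T_def q_def \<beta>_def by simp
    \<comment> \<open>Dividing by \<open>P\<close> transfers summability from \<open>e n\<close> to \<open>T\<close>, so that \<open>suminf\<close> is linear on it.\<close>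
    have "P \<noteq> 0"
    proof -
      have less: "cmod (x * y) < 1" if "cmod x < 1" "cmod y < 1" for x y
        using that mult_strict_mono'[of "cmod x" 1 "cmod y" 1] by (simp add: norm_mult)
      have "cmod (- \<beta>) < 1" "cmod (- \<beta> * p) < 1" "cmod (\<beta>\<^sup>2) < 1" "cmod (\<beta> * p) < 1"
        using less[OF \<beta>1(1) p(1)] less[OF \<beta>1(1) \<beta>1(1)] \<beta>1 by (simp_all add: power2_eq_square)
      from this[THEN qpoch_neq_0[OF _ q1(1)]] qpoch_neq_0[OF \<beta>1(1) q1(1)] qpoch_neq_0[OF \<gamma>(1) q1(1)]
      show ?thesis by (simp add: P_def pm_def)
    qed
    moreover have "summable (e n)"
    proof (rule summable_comparison_test')
      show "summable (\<lambda>k. K1 * K2 * y ^ k)"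
        using y by (intro summable_mult summable_geometric) auto
    qed (rule e_bound)
    ultimately have T: "summable T"
      unfolding e_eq by (simp add: summable_cmult_iff)
    have "(\<Sum>k. f n k) = (\<Sum>k. (P * (C n * t ^ n)) * T k)"
      by (simp add: f_def e_eq mult_ac)
    also have "\<dots> = P * (C n * t ^ n) * (\<Sum>k. T k)"
      by (rule suminf_mult[OF T])
    also have "(\<Sum>k. T k) = qphi (phi_upper \<beta> \<gamma> b p s n) (phi_lower \<beta> \<gamma> b p s n) q (\<gamma> * t\<^sup>2)"
      unfolding T_def by (rule qphi_balanced_length[symmetric]) (simp add: pm_def)
    also have "C n = rogers_C n (cos (of_real \<theta>)) \<gamma> q"
      unfolding C_def z_def w_def by (rule rogers_C_eq_rogers_sum[OF \<gamma> q1, symmetric])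
    finally show "(\<Sum>k. f n k) = qpochs (pm \<beta> @ [- \<beta> * p]) q n * t ^ n / qpochs [\<gamma>, \<beta>\<^sup>2, \<beta> * p] q n
          * rogers_C n (cos (of_real \<theta>)) \<gamma> q
          * qphi (phi_upper \<beta> \<gamma> b p s n) (phi_lower \<beta> \<gamma> b p s n) q (\<gamma> * t\<^sup>2)"
      unfolding P_def by simp
  qed
  finally show ?thesis unfolding z_def w_def .
qed

theorem theorem8:
  fixes x \<theta> \<beta> \<gamma> :: real
    and t q q_half q_quarter \<beta>_half :: complex
  assumes x: "x \<in> {-1..1}" "x = cos \<theta>"
    and \<beta>: "\<beta> \<in> {-1<..<1} - {0}"
    and \<gamma>: "\<gamma> \<in> {-1<..<1} - {0}"
    and q: "0 < cmod q" "cmod q < 1"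
    \<comment> \<open>\<open>q_half\<close>, \<open>q_quarter\<close>, \<open>\<beta>_half\<close> are consistent choices of the roots q^(1/2), q^(1/4), \<open>\<beta>\<close>^(1/2)\<close>
    and roots: "q_half ^ 2 = q" "q_quarter ^ 2 = q_half" "\<beta>_half ^ 2 = complex_of_real \<beta>"
    and t: "cmod t < min (cmod ((1 - \<beta>\<^sup>2) * (1 + q_half * \<bar>\<beta>\<bar>) * (1 - q * \<bar>\<gamma>\<bar>))) 1"
  shows
    "(\<lambda>n. qpochs (pm \<beta> @ [- \<beta> * q_half]) q n * t ^ n / qpochs [\<gamma>, \<beta>\<^sup>2, \<beta> * q_half] q n
          * rogers_C n x \<gamma> q
          * qphi
              ([\<beta> / \<gamma>, \<beta> * q ^ n]
                @ pm (\<i> * (\<beta>_half * q_half ^ n)) @ pm (\<i> * (\<beta>_half * q_half ^ (n + 1)))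
                @ pm (\<i> * (\<beta>_half * q_half ^ n * q_quarter)) @ pm (\<i> * (\<beta>_half * q_half ^ (n + 1) * q_quarter)))
              ([\<gamma> * q ^ (n + 1)]
                @ pm (\<beta> * q_half ^ n) @ pm (\<beta> * q_half ^ (n + 1))
                @ pm (\<beta>_half * q_half ^ n * q_quarter) @ pm (\<beta>_half * q_half ^ (n + 1) * q_quarter))
              q (\<gamma> * t\<^sup>2))
     sums
       (qphi [\<beta>_half * exp (\<i> * \<theta>), q_half * \<beta>_half * exp (\<i> * \<theta>)] [\<beta> * q_half] q (t * exp (- \<i> * \<theta>))
        * qphi [- \<beta>_half * exp (- \<i> * \<theta>), - (q_half * \<beta>_half) * exp (- \<i> * \<theta>)] [\<beta> * q_half] q
            (t * exp (\<i> * \<theta>)))"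
proof -
  have b: "cmod \<beta>_half < 1" "\<beta>_half \<noteq> 0"
  proof -
    have "cmod \<beta>_half ^ 2 = \<bar>\<beta>\<bar>"
      using arg_cong[OF roots(3), of cmod] by (simp add: norm_power)
    then have "cmod \<beta>_half ^ 2 < 1" using \<beta> by auto
    then show "cmod \<beta>_half < 1" by (simp add: abs_square_less_1)
    show "\<beta>_half \<noteq> 0" using roots(3) \<beta> by auto
  qed
  have p: "cmod q_half < 1" "q_half \<noteq> 0"
  proof -
    have "cmod q_half ^ 2 < 1" using q roots(1) by (metis norm_power)
    then show "cmod q_half < 1" by (simp add: abs_square_less_1)
    show "q_half \<noteq> 0" using roots(1) q by auto
  qed
  have \<gamma>': "cmod (complex_of_real \<gamma>) < 1" "complex_of_real \<gamma> \<noteq> 0"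
    using \<gamma> by auto
  have t1: "cmod t < 1" using t by simp
  have x': "complex_of_real x = cos (complex_of_real \<theta>)"
    using x(2) by (simp add: cos_of_real)
  show ?thesis
    using product_rogers_expansion[OF \<gamma>' b p roots(2) t1]
    unfolding roots(1,3) x' by simp
qed

end
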